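(* Let $G$ be a metric graph, let $\mathcal{N}$ be the set of Borel probability measures on $G$ with the weak-$\ast$ topology, and let $\widetilde{\mathcal{N}}$ be a dense subset of $\mathcal{N}$. Then $$\sup_{\mu\in\widetilde{\mathcal{N}}}\lambda_k(H_\mu)=+\infty\qquad\text{for all } k\ge 1.$$
   Context: A metric graph $G=(V,E,\ell)$ is given by a finite connected graph $(V,E)$ (loops and multiple edges allowed) and edge lengths $\ell:E\to(0,\infty)$: each edge $e$ is (after choosing an orientation) identified with the interval $[0,\ell(e)]$, and $G$ is the compact topological space obtained by gluing endpoints of edges corresponding to the same vertex. $dx$ is the Lebesgue measure on $G$. $H^1(G)$ is the space of continuous $f:G\to\mathbb{R}$ whose restriction to every open edge lies in $H^1((0,\ell(e)))$; $q(f,g)=\int_G f'g'\,dx$. A function $f\in H^1(G)$ is harmonic on an open set $O\subset G$ if $q(f,g)=0$ for all $g\in H^1(G)$ with $g\equiv 0$ on $G\setminus O$. For $\mu\in\mathcal{N}$, let $H^1(G,\mu)=\{f\in H^1(G): f \text{ harmonic on } G\setminus\operatorname{supp}\mu\}$, regarded (injectively) as a dense subspace of $L^2(G,\mu)$. $H_\mu$ is the non-negative self-adjoint operator in $L^2(G,\mu)$ associated with the closed form $q|_{H^1(G,\mu)}$: $f\in\operatorname{dom}(H_\mu)$ and $H_\mu f=g$ iff $f\in H^1(G,\mu)$ and $q(f,\varphi)=\int_G g\varphi\,d\mu$ for all $\varphi\in H^1(G,\mu)$. Its spectrum is discrete; its eigenvalues, counted with multiplicity, are $0=\lambda_0(H_\mu)<\lambda_1(H_\mu)\le\lambda_2(H_\mu)\le\cdots$,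 with the convention $\lambda_k(H_\mu):=+\infty$ for $k\ge\dim L^2(G,\mu)$. The weak-$\ast$ topology is the topology induced by the maps $\mu\mapsto\int_G f\,d\mu$, $f\in C(G)$. *)

theory Defs
  imports "HOL-Probability.Probability" "Graph_Theory.Digraph_Component"
begin

text \<open>
  The combinatorial graph is a finite digraph that is connected in the undirected sense; loops,
  parallel edges and the one-vertex graph without edges are allowed. The direction of an arc
  \<open>e\<close> only records the orientation by which \<open>e\<close> is identified with the interval from \<open>0\<close>
  (tail) to \<open>l e\<close> (head).
\<close>

locale metric_graph = fin_digraph G
  for G :: "('v, 'e) pre_digraph" and l :: "'e \<Rightarrow> real" +
  assumes connected: "Digraph_Component.connected G"
    and length_pos: "\<And>e. e \<in> arcs G \<Longrightarrow> 0 < l e"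

datatype ('v, 'e) point = Vertex 'v | Inner 'e real

definition points :: "('v, 'e) pre_digraph \<Rightarrow> ('e \<Rightarrow> real) \<Rightarrow> ('v, 'e) point set" where
  "points G l = Vertex ` verts G \<union> {Inner e t | e t. e \<in> arcs G \<and> 0 < t \<and> t < l e}"

text \<open>The gluing map, of interest only for \<open>t\<close> in \<open>{0..l e}\<close>.\<close>

definition edge_map ::
    "('v, 'e) pre_digraph \<Rightarrow> ('e \<Rightarrow> real) \<Rightarrow> 'e \<Rightarrow> real \<Rightarrow> ('v, 'e) point" where
  "edge_map G l e t =
     (if t \<le> 0 then Vertex (tail G e) else if l e \<le> t then Vertex (head G e) else Inner e t)"

text \<open>
  The quotient topology of the disjoint union of all the intervals \<open>{0..l e}\<close> and the discrete
  vertex set (the latter imposes no condition on \<open>U\<close>).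
\<close>

definition graph_topology ::
    "('v, 'e) pre_digraph \<Rightarrow> ('e \<Rightarrow> real) \<Rightarrow> ('v, 'e) point topology" where
  "graph_topology G l = topology (\<lambda>U. U \<subseteq> points G l \<and>
     (\<forall>e\<in>arcs G. openin (top_of_set {0..l e}) {t \<in> {0..l e}. edge_map G l e t \<in> U}))"

lemma openin_graph_topology:
  "openin (graph_topology G l) U \<longleftrightarrow> U \<subseteq> points G l \<and>
     (\<forall>e\<in>arcs G. openin (top_of_set {0..l e}) {t \<in> {0..l e}. edge_map G l e t \<in> U})"
proof -
  have 1: "{t \<in> {0..l e}. edge_map G l e t \<in> S \<inter> T} =
      {t \<in> {0..l e}. edge_map G l e t \<in> S} \<inter> {t \<in> {0..l e}. edge_map G l e t \<in> T}" for e S T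
    by auto
  have 2: "{t \<in> {0..l e}. edge_map G l e t \<in> \<Union>K} =
      (\<Union>S\<in>K. {t \<in> {0..l e}. edge_map G l e t \<in> S})" for e K
    by auto
  have "istopology (\<lambda>U. U \<subseteq> points G l \<and>
     (\<forall>e\<in>arcs G. openin (top_of_set {0..l e}) {t \<in> {0..l e}. edge_map G l e t \<in> U}))"
    unfolding istopology_def 1 2 by (intro conjI allI impI ballI openin_Int openin_Union) auto
  then show ?thesis
    unfolding graph_topology_def by (simp add: topology_inverse')
qed

lemma (in metric_graph) topspace_graph_topology: "topspace (graph_topology G l) = points G l"
proof
  show "topspace (graph_topology G l) \<subseteq> points G l"
    using openin_topspace[of "graph_topology G l"] unfolding openin_graph_topology by blast
  have "{t \<in> {0..l e}. edge_map G l e t \<in> points G l} = {0..l e}" if "e \<in> arcs G" for e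
    using that by (auto simp: points_def edge_map_def)
  then have "openin (graph_topology G l) (points G l)"
    unfolding openin_graph_topology by simp
  then show "points G l \<subseteq> topspace (graph_topology G l)"
    by (rule openin_subset)
qed

definition prob_measures ::
    "('v, 'e) pre_digraph \<Rightarrow> ('e \<Rightarrow> real) \<Rightarrow> ('v, 'e) point measure set" where
  "prob_measures G l = {\<mu>. prob_space \<mu> \<and>
     sets \<mu> = sets (sigma (points G l) {U. openin (graph_topology G l) U})}"

definition weak_star_topology ::
    "('v, 'e) pre_digraph \<Rightarrow> ('e \<Rightarrow> real) \<Rightarrow> ('v, 'e) point measure topology" where
  "weak_star_topology G l = topology_generated_by
     {{\<mu> \<in> prob_measures G l. (LINT x|\<mu>. f x) \<in> W} | f W.
        continuous_map (graph_topology G l) euclideanreal f \<and> open W}"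

definition measure_supp ::
    "('v, 'e) pre_digraph \<Rightarrow> ('e \<Rightarrow> real) \<Rightarrow> ('v, 'e) point measure \<Rightarrow> ('v, 'e) point set" where
  "measure_supp G l \<mu> =
     {x \<in> points G l. \<forall>U. openin (graph_topology G l) U \<and> x \<in> U \<longrightarrow> 0 < emeasure \<mu> U}"

definition L2 :: "'a measure \<Rightarrow> ('a \<Rightarrow> real) set" where
  "L2 M = {f \<in> borel_measurable M. integrable M (\<lambda>x. (f x)\<^sup>2)}"

text \<open>Smooth functions with compact support in the open interval from \<open>a\<close> to \<open>b\<close>.\<close>

definition test_functions :: "real \<Rightarrow> real \<Rightarrow> (real \<Rightarrow> real) set" where
  "test_functions a b = {\<phi>. (\<forall>n x. (deriv ^^ n) \<phi> differentiable at x) \<and>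
     (\<exists>K. compact K \<and> K \<subseteq> {a<..<b} \<and> (\<forall>x. x \<notin> K \<longrightarrow> \<phi> x = 0))}"

definition is_weak_deriv :: "real \<Rightarrow> real \<Rightarrow> (real \<Rightarrow> real) \<Rightarrow> (real \<Rightarrow> real) \<Rightarrow> bool" where
  "is_weak_deriv a b u v \<longleftrightarrow> v \<in> L2 (restrict_space lborel {a<..<b}) \<and>
     (\<forall>\<phi>\<in>test_functions a b.
        (LINT t|restrict_space lborel {a<..<b}. u t * deriv \<phi> t) =
          - (LINT t|restrict_space lborel {a<..<b}. v t * \<phi> t))"

definition H1_interval :: "real \<Rightarrow> real \<Rightarrow> (real \<Rightarrow> real) set" where
  "H1_interval a b = {u \<in> L2 (restrict_space lborel {a<..<b}). \<exists>v. is_weak_deriv a b u v}"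

text \<open>Weak derivatives are unique up to null sets, so the choice does not affect integrals.\<close>

definition weak_deriv :: "real \<Rightarrow> real \<Rightarrow> (real \<Rightarrow> real) \<Rightarrow> real \<Rightarrow> real" where
  "weak_deriv a b u = (SOME v. is_weak_deriv a b u v)"

text \<open>
  Functions on the metric graph are represented by functions on the type of points, whose values
  outside \<open>points G l\<close> are irrelevant.
\<close>

definition H1 :: "('v, 'e) pre_digraph \<Rightarrow> ('e \<Rightarrow> real) \<Rightarrow> (('v, 'e) point \<Rightarrow> real) set" where
  "H1 G l = {f. continuous_map (graph_topology G l) euclideanreal f \<and>
     (\<forall>e\<in>arcs G. (\<lambda>t. f (edge_map G l e t)) \<in> H1_interval 0 (l e))}"

definition energy_form ::
    "('v, 'e) pre_digraph \<Rightarrow> ('e \<Rightarrow> real) \<Rightarrow>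
     (('v, 'e) point \<Rightarrow> real) \<Rightarrow> (('v, 'e) point \<Rightarrow> real) \<Rightarrow> real" where
  "energy_form G l f g = (\<Sum>e\<in>arcs G. LINT t|restrict_space lborel {0<..<l e}.
     weak_deriv 0 (l e) (\<lambda>t. f (edge_map G l e t)) t *
     weak_deriv 0 (l e) (\<lambda>t. g (edge_map G l e t)) t)"

definition harmonic_on ::
    "('v, 'e) pre_digraph \<Rightarrow> ('e \<Rightarrow> real) \<Rightarrow>
     ('v, 'e) point set \<Rightarrow> (('v, 'e) point \<Rightarrow> real) \<Rightarrow> bool" where
  "harmonic_on G l S f \<longleftrightarrow>
     (\<forall>g\<in>H1 G l. (\<forall>x\<in>points G l - S. g x = 0) \<longrightarrow> energy_form G l f g = 0)"

definition H1_measure ::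
    "('v, 'e) pre_digraph \<Rightarrow> ('e \<Rightarrow> real) \<Rightarrow>
     ('v, 'e) point measure \<Rightarrow> (('v, 'e) point \<Rightarrow> real) set" where
  "H1_measure G l \<mu> = {f \<in> H1 G l. harmonic_on G l (points G l - measure_supp G l \<mu>) f}"

text \<open>
  The graph of the operator: \<open>f\<close> is in the domain and is mapped to \<open>g\<close>, where \<open>g\<close> is
  determined up to null sets of \<open>\<mu>\<close>.
\<close>

definition operator_graph ::
    "('v, 'e) pre_digraph \<Rightarrow> ('e \<Rightarrow> real) \<Rightarrow> ('v, 'e) point measure \<Rightarrow>
     (('v, 'e) point \<Rightarrow> real) \<Rightarrow> (('v, 'e) point \<Rightarrow> real) \<Rightarrow> bool" where
  "operator_graph G l \<mu> f g \<longleftrightarrow> f \<in> H1_measure G l \<mu> \<and> g \<in> L2 \<mu> \<and>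
     (\<forall>\<phi>\<in>H1_measure G l \<mu>. energy_form G l f \<phi> = (LINT x|\<mu>. g x * \<phi> x))"

definition eigenspace ::
    "('v, 'e) pre_digraph \<Rightarrow> ('e \<Rightarrow> real) \<Rightarrow> ('v, 'e) point measure \<Rightarrow>
     real \<Rightarrow> (('v, 'e) point \<Rightarrow> real) set" where
  "eigenspace G l \<mu> r = {f. operator_graph G l \<mu> f (\<lambda>x. r * f x)}"

text \<open>
  Linear independence in the quotient of \<open>L2 M\<close> by almost everywhere equality, and the dimension
  there (possibly infinite) of a subspace given by representatives.
\<close>

definition L2_independent :: "'a measure \<Rightarrow> nat \<Rightarrow> (nat \<Rightarrow> 'a \<Rightarrow> real) \<Rightarrow> bool" where
  "L2_independent M n F \<longleftrightarrow>
     (\<forall>c. (AE x in M. (\<Sum>i<n. c i * F i x) = 0) \<longrightarrow> (\<forall>i<n. c i = 0))"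

definition L2_dim :: "'a measure \<Rightarrow> ('a \<Rightarrow> real) set \<Rightarrow> enat" where
  "L2_dim M S = Sup {enat n | n. \<exists>F. (\<forall>i<n. F i \<in> S) \<and> L2_independent M n F}"

text \<open>The number of eigenvalues that are at most \<open>t\<close>, counted with multiplicity.\<close>

definition eigenvalue_count ::
    "('v, 'e) pre_digraph \<Rightarrow> ('e \<Rightarrow> real) \<Rightarrow> ('v, 'e) point measure \<Rightarrow> real \<Rightarrow> enat" where
  "eigenvalue_count G l \<mu> t =
     Sup {\<Sum>r\<in>A. L2_dim \<mu> (eigenspace G l \<mu> r) | A. finite A \<and> A \<subseteq> {..t}}"

text \<open>
  The \<open>k\<close>-th smallest eigenvalue, counted with multiplicity from \<open>k = 0\<close>. If there are at most
  \<open>k\<close> eigenvalues, in particular if \<open>k\<close> is at least the dimension of the Hilbert space, the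
  infimum is over the empty set and the value is \<open>\<infinity>\<close>.
\<close>

definition eigenvalue ::
    "('v, 'e) pre_digraph \<Rightarrow> ('e \<Rightarrow> real) \<Rightarrow> ('v, 'e) point measure \<Rightarrow> nat \<Rightarrow> ereal" where
  "eigenvalue G l \<mu> k = Inf {ereal t | t. enat k < eigenvalue_count G l \<mu> t}"

end

theory Submission
  imports Defs "HOL-Computational_Algebra.Polynomial"
begin

text \<open>
  It suffices to make \<open>\<lambda>\<^sub>1\<close> large, and this happens when \<open>\<mu>\<close> is weak-* close to a point mass at
  some \<open>x0\<close>. A function in \<open>H1\<close> satisfies \<open>(f x - f x0)\<^sup>2 \<le> D x * q(f, f)\<close> with a continuous \<open>D\<close>
  vanishing at \<open>x0\<close> (the distance to \<open>x0\<close> would do), so if \<open>f\<close> has mean zero, then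
  \<open>\<integral> f\<^sup>2 d\<mu> \<le> \<integral> (f - f x0)\<^sup>2 d\<mu> \<le> q(f, f) * \<integral> D d\<mu>\<close>. Two independent eigenfunctions with
  eigenvalues at most \<open>t\<close> have a nontrivial linear combination of mean zero, for which
  \<open>q(f, f) \<le> t * \<integral> f\<^sup>2 d\<mu>\<close>; hence \<open>1 \<le> t * \<integral> D d\<mu>\<close>, and \<open>\<integral> D d\<mu>\<close> is arbitrarily small on a
  weak-* dense set.
\<close>

section \<open>Smooth step functions\<close>

text \<open>The first condition in \<open>test_functions\<close>, separated from compact support so
  that it can also be proved for step functions.\<close>

definition smooth :: "(real \<Rightarrow> real) \<Rightarrow> bool" where
  "smooth f \<longleftrightarrow> (\<forall>n x. (deriv ^^ n) f differentiable at x)"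

lemma higher_deriv_eq:
  assumes F: "\<And>n x. (F n has_real_derivative F (Suc n) x) (at x)"
  shows "(deriv ^^ n) (F 0) = F n"
proof (induction n)
  case (Suc n)
  then show ?case using DERIV_imp_deriv[OF F] by auto
qed simp

text \<open>Exhibiting a whole sequence of successive derivatives lets closure properties be checked
  term by term, without computing iterates of \<open>deriv\<close>.\<close>

lemma smooth_iff_family:
  "smooth f \<longleftrightarrow> (\<exists>F. F 0 = f \<and> (\<forall>n x. (F n has_real_derivative F (Suc n) x) (at x)))"
proof
  assume "smooth f"
  then have "((deriv ^^ n) f has_real_derivative (deriv ^^ Suc n) f x) (at x)" for n x
    by (auto simp: smooth_def DERIV_deriv_iff_real_differentiable)
  then show "\<exists>F. F 0 = f \<and> (\<forall>n x. (F n has_real_derivative F (Suc n) x) (at x))"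
    by (intro exI[of _ "\<lambda>n. (deriv ^^ n) f"]) auto
next
  assume "\<exists>F. F 0 = f \<and> (\<forall>n x. (F n has_real_derivative F (Suc n) x) (at x))"
  then obtain F where F: "F 0 = f" "\<And>n x. (F n has_real_derivative F (Suc n) x) (at x)"
    by blast
  then show "smooth f"
    using higher_deriv_eq[of F] real_differentiable_def by (auto simp: smooth_def)
qed

lemma smooth_diff:
  assumes "smooth f" "smooth g"
  shows "smooth (\<lambda>x. f x - g x)"
proof -
  obtain F G where "F 0 = f" "\<And>n x. (F n has_real_derivative F (Suc n) x) (at x)"
    "G 0 = g" "\<And>n x. (G n has_real_derivative G (Suc n) x) (at x)"
    using assms unfolding smooth_iff_family by metis
  then show ?thesis
    unfolding smooth_iff_family
    by (intro exI[of _ "\<lambda>n x. F n x - G n x"]) (auto intro!: derivative_intros)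
qed

lemma smooth_divide_const:
  assumes "smooth f"
  shows "smooth (\<lambda>x. f x / c)"
proof -
  obtain F where "F 0 = f" "\<And>n x. (F n has_real_derivative F (Suc n) x) (at x)"
    using assms unfolding smooth_iff_family by metis
  then show ?thesis
    unfolding smooth_iff_family
    by (intro exI[of _ "\<lambda>n x. F n x / c"]) (auto intro!: DERIV_cdivide)
qed

lemma smooth_antideriv:
  assumes "\<And>x. (f has_real_derivative g x) (at x)" "smooth g"
  shows "smooth f"
proof -
  obtain G where G: "G 0 = g" "\<And>n x. (G n has_real_derivative G (Suc n) x) (at x)"
    using assms(2) unfolding smooth_iff_family by metis
  define F where "F = case_nat f G"
  have "F 0 = f" "(F n has_real_derivative F (Suc n) x) (at x)" for n x
    using G assms(1) by (auto simp: F_def split: nat.splits)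
  then show ?thesis
    unfolding smooth_iff_family by blast
qed

text \<open>A single term of the exponential series is at most the whole sum. With y = 1/w this
  shows that exp(-1/w) decays faster than any power of w.\<close>

lemma power_le_fact_exp:
  fixes y :: real
  assumes "0 \<le> y"
  shows "y ^ n \<le> fact n * exp y"
proof -
  have "(\<Sum>i\<in>{n}. y ^ i /\<^sub>R fact i) \<le> (\<Sum>i. y ^ i /\<^sub>R fact i)"
    using assms by (intro sum_le_suminf sums_summable[OF exp_converges]) auto
  then show ?thesis
    using sums_unique[OF exp_converges[of y]] by (simp add: field_simps)
qed

text \<open>With w = (x - a)(b - x), the classical bump exp(-1/w) times p/w^k. The rational factor
  makes the family closed under differentiation.\<close>

definition bump :: "real \<Rightarrow> real \<Rightarrow> real poly \<Rightarrow> nat \<Rightarrow> real \<Rightarrow> real" where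
  "bump a b p k x = (if a < x \<and> x < b
     then poly p x * exp (- 1 / ((x - a) * (b - x))) / ((x - a) * (b - x)) ^ k else 0)"

text \<open>With w = (x - a)(b - x), exp(-1/w)/w^k is at most (k + 2)! w^2, and w is at most (b -
  a)|x - c|. Quadratic decay towards c forces derivative 0 there, in particular at the
  endpoints.\<close>

lemma bump_quadratic:
  assumes "a < b"
  obtains C where "\<And>x c. c \<notin> {a<..<b} \<Longrightarrow> \<bar>bump a b p k x\<bar> \<le> C * (x - c)\<^sup>2"
proof -
  have "compact (poly p ` {a..b})"
    by (intro compact_continuous_image continuous_intros) auto
  then obtain B where B: "\<And>x. x \<in> {a..b} \<Longrightarrow> \<bar>poly p x\<bar> \<le> B"
    using compact_imp_bounded bounded_iff by (metis imageI real_norm_def)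
  have B0: "0 \<le> B"
    using B[of a] assms by (smt (verit) atLeastAtMost_iff)
  define C where "C = B * fact (k + 2) * (b - a)\<^sup>2"
  have C0: "0 \<le> C"
    using B0 by (simp add: C_def)
  have "\<bar>bump a b p k x\<bar> \<le> C * (x - c)\<^sup>2" if c: "c \<notin> {a<..<b}" for x c
  proof (cases "a < x \<and> x < b")
    case True
    define w where "w = (x - a) * (b - x)"
    have w: "0 < w" using True by (simp add: w_def)
    have "(1 / w) ^ (k + 2) \<le> fact (k + 2) * exp (1 / w)"
      using w by (intro power_le_fact_exp) simp
    then have "exp (- (1 / w)) / w ^ k \<le> fact (k + 2) * w\<^sup>2"
      using w by (simp add: exp_minus field_simps power_add power2_eq_square)
    moreover have "w \<le> (b - a) * \<bar>x - c\<bar>"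
    proof (cases "c \<le> a")
      case T: True
      have "w \<le> (x - a) * (b - a)" unfolding w_def using True by (intro mult_left_mono) auto
      also have "\<dots> \<le> \<bar>x - c\<bar> * (b - a)" using T True assms by (intro mult_right_mono) auto
      finally show ?thesis by (simp add: mult.commute)
    next
      case False
      then have F: "b \<le> c" using c by auto
      have "w \<le> (b - a) * (b - x)" unfolding w_def using True by (intro mult_right_mono) auto
      also have "\<dots> \<le> (b - a) * \<bar>x - c\<bar>" using F True assms by (intro mult_left_mono) auto
      finally show ?thesis .
    qed
    then have "w\<^sup>2 \<le> ((b - a) * \<bar>x - c\<bar>)\<^sup>2"
      using w by (intro power_mono) auto
    then have "w\<^sup>2 \<le> (b - a)\<^sup>2 * (x - c)\<^sup>2"
      by (simp add: power_mult_distrib)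
    ultimately have "exp (- (1 / w)) / w ^ k \<le> fact (k + 2) * ((b - a)\<^sup>2 * (x - c)\<^sup>2)"
      by (smt (verit) fact_ge_zero mult_left_mono)
    then have "\<bar>poly p x\<bar> * (exp (- (1 / w)) / w ^ k)
        \<le> B * (fact (k + 2) * ((b - a)\<^sup>2 * (x - c)\<^sup>2))"
      using B[of x] B0 True w by (intro mult_mono) auto
    moreover have "bump a b p k x = poly p x * (exp (- (1 / w)) / w ^ k)"
      using True by (simp add: bump_def w_def)
    ultimately show ?thesis
      using w by (simp add: C_def abs_mult mult.assoc del: fact_Suc)
  qed (use C0 in \<open>auto simp: bump_def\<close>)
  then show thesis by (rule that)
qed

lemma bump_has_derivative:
  assumes "a < b"
  shows "\<exists>q. \<forall>x. (bump a b p k has_real_derivative bump a b q (k + 2) x) (at x)"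
proof -
  define W where "W = [:- a, 1:] * [:b, - 1:]"
  have W: "poly W x = (x - a) * (b - x)" for x
    by (simp add: W_def algebra_simps)
  \<comment> \<open>The numerator of the derivative of p exp(-1/W)/W^k over the common denominator
    W^(k + 2); the last summand comes from the exponential.\<close>
  define q where "q = pderiv p * W\<^sup>2 - smult (real k) (p * pderiv W * W) + p * pderiv W"
  have "(bump a b p k has_real_derivative bump a b q (k + 2) x) (at x)" for x
  proof (cases "x \<in> {a<..<b}")
    case True
    then have w: "0 < poly W x" by (simp add: W)
    have "((\<lambda>x. poly p x * exp (- 1 / poly W x) / poly W x ^ k) has_real_derivative
        poly q x * exp (- 1 / poly W x) / poly W x ^ (k + 2)) (at x)"
    proof -
      have e: "((\<lambda>x. exp (- 1 / poly W x)) has_real_derivative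
          exp (- 1 / poly W x) * (poly (pderiv W) x / (poly W x)\<^sup>2)) (at x)"
        using w by (auto intro!: derivative_eq_intros poly_DERIV simp: power2_eq_square)
      have i: "((\<lambda>x. 1 / poly W x ^ k) has_real_derivative
          - (real k * poly (pderiv W) x) / poly W x ^ (k + 1)) (at x)"
      proof (cases k)
        case (Suc m)
        have "((\<lambda>x. poly W x ^ Suc m) has_real_derivative
            real (Suc m) * (poly (pderiv W) x * poly W x ^ m)) (at x)"
          using DERIV_power[OF poly_DERIV[of W x], of "Suc m"] by simp
        then show ?thesis
          unfolding Suc
          by (rule DERIV_cong[OF DERIV_divide[OF DERIV_const[of 1]]]) (use w in \<open>auto simp: field_simps\<close>)
      qed simp
      have "((\<lambda>x. poly p x * exp (- 1 / poly W x) * (1 / poly W x ^ k)) has_real_derivative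
          poly q x * exp (- 1 / poly W x) / poly W x ^ (k + 2)) (at x)"
        by (rule DERIV_cong[OF DERIV_mult[OF DERIV_mult[OF poly_DERIV e] i]])
          (use w in \<open>simp add: q_def field_simps power2_eq_square\<close>)
      then show ?thesis by simp
    qed
    then have "(bump a b p k has_real_derivative
        poly q x * exp (- 1 / poly W x) / poly W x ^ (k + 2)) (at x)"
      by (rule has_field_derivative_transform_within_open[of _ _ _ "{a<..<b}"])
        (use True in \<open>auto simp: bump_def W\<close>)
    then show ?thesis using True by (simp add: bump_def W)
  next
    case False
    \<comment> \<open>Off the open interval the bump is 0 at x, and the quadratic bound with c = x
      makes the difference quotient at most C|y - x|.\<close>
    obtain C where C: "\<And>y c. c \<notin> {a<..<b} \<Longrightarrow> \<bar>bump a b p k y\<bar> \<le> C * (y - c)\<^sup>2"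
      using bump_quadratic[OF assms] by blast
    have x: "bump a b p k x = 0" "bump a b q (k + 2) x = 0"
      using False by (auto simp: bump_def)
    have "((\<lambda>y. bump a b p k y / (y - x)) \<longlongrightarrow> 0) (at x)"
    proof (rule Lim_null_comparison)
      have "norm (bump a b p k y / (y - x)) \<le> C * \<bar>y - x\<bar>" if "y \<noteq> x" for y
        using C[OF False, of y] that
        by (simp add: abs_divide divide_le_eq power2_eq_square abs_mult_self_eq mult.assoc)
      then show "\<forall>\<^sub>F y in at x. norm (bump a b p k y / (y - x)) \<le> C * \<bar>y - x\<bar>"
        by (auto simp: eventually_at_filter)
      show "((\<lambda>y. C * \<bar>y - x\<bar>) \<longlongrightarrow> 0) (at x)"
        by (rule tendsto_eq_intros refl | simp)+
    qed
    then show ?thesis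
      unfolding has_field_derivative_iff x by simp
  qed
  then show ?thesis by blast
qed

lemma smooth_bump:
  assumes "a < b"
  shows "smooth (bump a b p k)"
proof -
  have "\<exists>q k. (deriv ^^ n) (bump a b p k') = bump a b q k" for n k'
  proof (induction n)
    case (Suc n)
    then obtain q k where "(deriv ^^ n) (bump a b p k') = bump a b q k" by blast
    moreover obtain r where "\<forall>x. (bump a b q k has_real_derivative bump a b r (k + 2) x) (at x)"
      using bump_has_derivative[OF assms] by blast
    then have "deriv (bump a b q k) = bump a b r (k + 2)"
      by (auto intro!: ext DERIV_imp_deriv)
    ultimately show ?case by auto
  qed auto
  then show ?thesis
    unfolding smooth_def using bump_has_derivative[OF assms] real_differentiable_def by metis
qed

text \<open>\<open>\<rho>\<close> is a probability density concentrated between \<open>a\<close> and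
  \<open>b\<close>, and \<open>S\<close> is its distribution function. For a short interval
  \<open>\<rho>\<close> approximates a point mass.\<close>

definition smooth_step :: "real \<Rightarrow> real \<Rightarrow> (real \<Rightarrow> real) \<Rightarrow> (real \<Rightarrow> real) \<Rightarrow> bool" where
  "smooth_step a b S \<rho> \<longleftrightarrow> smooth S \<and> (\<forall>x. (S has_real_derivative \<rho> x) (at x)) \<and>
     continuous_on UNIV \<rho> \<and> (\<forall>x\<le>a. S x = 0) \<and> (\<forall>x\<ge>b. S x = 1) \<and>
     (\<forall>x. 0 \<le> \<rho> x) \<and> (\<forall>x. x \<notin> {a<..<b} \<longrightarrow> \<rho> x = 0)"

lemma smooth_stepD:
  assumes "smooth_step a b S \<rho>"
  shows "smooth S" "\<And>x. (S has_real_derivative \<rho> x) (at x)" "continuous_on UNIV \<rho>"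
    "\<And>x. x \<le> a \<Longrightarrow> S x = 0" "\<And>x. b \<le> x \<Longrightarrow> S x = 1"
    "\<And>x. 0 \<le> \<rho> x" "\<And>x. x \<notin> {a<..<b} \<Longrightarrow> \<rho> x = 0"
  using assms by (simp_all add: smooth_step_def)

text \<open>The step is a primitive of a bump, divided by its final value.\<close>

lemma ex_smooth_step:
  fixes a b :: real
  assumes "a < b"
  shows "\<exists>S \<rho>. smooth_step a b S \<rho>"
proof -
  define \<beta> where "\<beta> = bump a b 1 0"
  have \<beta>0: "\<And>x. 0 \<le> \<beta> x" "\<And>x. x \<notin> {a<..<b} \<Longrightarrow> \<beta> x = 0" "\<And>x. x \<in> {a<..<b} \<Longrightarrow> \<beta> x > 0"
    by (auto simp: \<beta>_def bump_def)
  have cont: "continuous_on A \<beta>" for A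
    using bump_has_derivative[OF assms, of 1 0] unfolding \<beta>_def
    by (metis DERIV_isCont continuous_at_imp_continuous_on)
  \<comment> \<open>Starting at a - 1 keeps every x \<ge> a in the interior of an integration
    interval, so the derivative there is two-sided even at a.\<close>
  define T where "T x = integral {a - 1..x} \<beta>" for x
  have T0: "T x = 0" if "x \<le> a" for x
  proof -
    have "T x = integral {a - 1..x} (\<lambda>_. 0)"
      unfolding T_def using that by (intro integral_cong) (auto simp: \<beta>0)
    then show ?thesis by simp
  qed
  have T': "(T has_real_derivative \<beta> x) (at x)" for x
  proof (cases "x < a")
    case True
    have "((\<lambda>_. 0) has_real_derivative 0) (at x)" by simp
    then have "(T has_real_derivative 0) (at x)"
      by (rule has_field_derivative_transform_within_open[of _ _ _ "{..<a}"]) (use True T0 in auto)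
    then show ?thesis using True \<beta>0 by simp
  next
    case False
    then have "(T has_real_derivative \<beta> x) (at x within {a - 1..x + 1})"
      unfolding T_def by (intro integral_has_real_derivative cont) auto
    then show ?thesis
      using False at_within_Icc_at[of "a - 1" x "x + 1"] by simp
  qed
  have T_const: "T x = T b" if "b \<le> x" for x
  proof (cases "b = x")
    case False
    show ?thesis
    proof (rule DERIV_isconst_end[of b x T])
      show "continuous_on {b..x} T"
        using T' by (blast intro: DERIV_continuous_on has_field_derivative_at_within)
      show "\<And>y. b < y \<Longrightarrow> y < x \<Longrightarrow> (T has_real_derivative 0) (at y)"
        by (metis T' \<beta>0(2) greaterThanLessThan_iff less_asym)
    qed (use that False in auto)
  qed simp
  have Tb: "0 < T b"
  proof -
    have "T a < T b"
      by (rule DERIV_pos_imp_increasing_open[OF assms])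
       (use T' \<beta>0 in \<open>auto intro!: DERIV_continuous_on[OF has_field_derivative_at_within] exI\<close>)
    then show ?thesis using T0 by simp
  qed
  have "smooth_step a b (\<lambda>x. T x / T b) (\<lambda>x. \<beta> x / T b)"
    unfolding smooth_step_def
  proof (intro conjI allI impI)
    have "smooth T"
      using T' smooth_bump[OF assms] unfolding \<beta>_def by (rule smooth_antideriv)
    then show "smooth (\<lambda>x. T x / T b)" by (rule smooth_divide_const)
    show "((\<lambda>x. T x / T b) has_real_derivative \<beta> x / T b) (at x)" for x
      by (intro DERIV_cdivide T')
    show "continuous_on UNIV (\<lambda>x. \<beta> x / T b)"
      using Tb by (intro continuous_intros cont) auto
    show "T x / T b = 0" if "x \<le> a" for x using T0[OF that] by simp
    show "T x / T b = 1" if "b \<le> x" for x using T_const[OF that] Tb by simp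
    show "0 \<le> \<beta> x / T b" for x using \<beta>0(1) Tb by simp
    show "\<beta> x / T b = 0" if "x \<notin> {a<..<b}" for x using \<beta>0(2)[OF that] by simp
  qed
  then show ?thesis by blast
qed

section \<open>Weak derivatives on an interval\<close>

lemma L2_integrable_mult:
  assumes "f \<in> L2 M" "g \<in> L2 M"
  shows "integrable M (\<lambda>x. f x * g x)"
proof (rule Bochner_Integration.integrable_bound)
  show "integrable M (\<lambda>x. (f x)\<^sup>2 + (g x)\<^sup>2)" "(\<lambda>x. f x * g x) \<in> borel_measurable M"
    using assms by (auto simp: L2_def)
  have "\<bar>f x * g x\<bar> \<le> (f x)\<^sup>2 + (g x)\<^sup>2" for x
    using sum_squares_bound[of "\<bar>f x\<bar>" "\<bar>g x\<bar>"] abs_ge_zero[of "f x * g x"]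
    unfolding abs_mult power2_abs by linarith
  then show "AE x in M. norm (f x * g x) \<le> norm ((f x)\<^sup>2 + (g x)\<^sup>2)"
    by auto
qed

lemma L2_linear:
  assumes "f \<in> L2 M" "g \<in> L2 M"
  shows "(\<lambda>x. \<alpha> * f x + \<beta> * g x) \<in> L2 M"
proof -
  have "(\<lambda>x. (\<alpha> * f x + \<beta> * g x)\<^sup>2)
      = (\<lambda>x. \<alpha>\<^sup>2 * (f x * f x) + 2 * \<alpha> * \<beta> * (f x * g x) + \<beta>\<^sup>2 * (g x * g x))"
    by (auto simp: power2_eq_square algebra_simps)
  then show ?thesis
    using assms L2_integrable_mult[OF assms(1,1)] L2_integrable_mult[OF assms]
      L2_integrable_mult[OF assms(2,2)]
    unfolding L2_def by auto
qed

lemma L2_integral_linear_square: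
  assumes "f \<in> L2 M" "g \<in> L2 M"
  shows "(LINT x|M. (\<alpha> * f x + \<beta> * g x)\<^sup>2) =
    \<alpha>\<^sup>2 * (LINT x|M. f x * f x) + 2 * \<alpha> * \<beta> * (LINT x|M. f x * g x) + \<beta>\<^sup>2 * (LINT x|M. g x * g x)"
proof -
  have "(\<lambda>x. (\<alpha> * f x + \<beta> * g x)\<^sup>2)
      = (\<lambda>x. \<alpha>\<^sup>2 * (f x * f x) + 2 * \<alpha> * \<beta> * (f x * g x) + \<beta>\<^sup>2 * (g x * g x))"
    by (auto simp: power2_eq_square algebra_simps)
  then show ?thesis
    using L2_integrable_mult[OF assms(1,1)] L2_integrable_mult[OF assms]
      L2_integrable_mult[OF assms(2,2)]
    by simp
qed

text \<open>The integral of (\<alpha> f + \<beta> g)^2 is a nonnegative quadratic form in \<alpha>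
  and \<beta>; suitable coefficients give the discriminant inequality.\<close>

lemma L2_Cauchy_Schwarz:
  assumes "f \<in> L2 M" "g \<in> L2 M"
  shows "(LINT x|M. f x * g x)\<^sup>2 \<le> (LINT x|M. (f x)\<^sup>2) * (LINT x|M. (g x)\<^sup>2)"
proof -
  define A B D where "A = (LINT x|M. f x * f x)" and "B = (LINT x|M. f x * g x)"
    and "D = (LINT x|M. g x * g x)"
  have q: "0 \<le> \<alpha>\<^sup>2 * A + 2 * \<alpha> * \<beta> * B + \<beta>\<^sup>2 * D" for \<alpha> \<beta>
    unfolding A_def B_def D_def L2_integral_linear_square[OF assms, symmetric] by simp
  have "0 \<le> D" by (simp add: D_def)
  have "B\<^sup>2 \<le> A * D"
  proof (cases "D = 0")
    case True
    have "B = 0"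
    proof (rule ccontr)
      assume "B \<noteq> 0"
      then show False
        \<comment> \<open>With D = 0 these coefficients give the form the value A - (A + 1) =
          -1.\<close>
        using q[of 1 "- (A + 1) / (2 * B)"] True by (simp add: field_simps)
    qed
    then show ?thesis using True by simp
  next
    case False
    then show ?thesis
      \<comment> \<open>The form takes the value D(AD - B^2) here, and D is positive.\<close>
      using q[of D "- B"] \<open>0 \<le> D\<close>
      by (simp add: power2_eq_square algebra_simps)
  qed
  then show ?thesis
    by (simp add: A_def B_def D_def power2_eq_square)
qed

section \<open>Integrals over an open interval\<close>

lemma integrable_open_interval:
  fixes f :: "real \<Rightarrow> real"
  assumes "continuous_on {a..b} f"
  shows "integrable (restrict_space lborel {a<..<b}) f"
proof -
  have "set_integrable lborel {a<..<b} f"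
    by (rule set_integrable_subset[OF borel_integrable_atLeastAtMost'[OF assms]]) auto
  then show ?thesis
    by (simp add: integrable_restrict_space set_integrable_def)
qed

lemma L2_open_interval:
  fixes f :: "real \<Rightarrow> real"
  assumes "continuous_on {a..b} f"
  shows "f \<in> L2 (restrict_space lborel {a<..<b})"
  using integrable_open_interval[OF assms] integrable_open_interval[of a b "\<lambda>x. (f x)\<^sup>2"]
  by (auto simp: L2_def intro!: continuous_intros assms)

lemma FTC_open_interval:
  fixes S :: "real \<Rightarrow> real"
  assumes "a \<le> b" "\<And>x. (S has_real_derivative \<rho> x) (at x)" "continuous_on {a..b} \<rho>"
  shows "(LINT x|restrict_space lborel {a<..<b}. \<rho> x) = S b - S a"
proof -
  have "(LBINT x=a..b. \<rho> x) = S b - S a"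
    by (rule interval_integral_FTC_finite)
      (use assms in \<open>auto simp: min_def max_def has_real_derivative_iff_has_vector_derivative[symmetric]
        intro: has_field_derivative_at_within\<close>)
  then show ?thesis
    using assms(1)
    by (simp add: interval_lebesgue_integral_def set_lebesgue_integral_def integral_restrict_space)
qed

lemma integral_indicator_diff:
  assumes "a \<le> s" "s \<le> t" "t \<le> b"
  shows "integrable (restrict_space lborel {a<..<b}) (indicat_real {s..t})"
    and "(LINT x|restrict_space lborel {a<..<b}. indicat_real {s..t} x) \<le> t - s"
proof -
  have 1: "indicat_real {a<..<b} x * indicat_real {s..t} x = indicat_real ({a<..<b} \<inter> {s..t}) x" for x
    by (simp add: indicator_inter_arith)
  have fin: "emeasure lborel ({a<..<b} \<inter> {s..t}) < \<infinity>"
    by (rule emeasure_bounded_finite) (auto intro: bounded_subset[of "{s..t}"])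
  then have "integrable lborel (indicat_real ({a<..<b} \<inter> {s..t}))"
    by (intro integrable_real_indicator) auto
  then show "integrable (restrict_space lborel {a<..<b}) (indicat_real {s..t})"
    by (simp add: integrable_restrict_space 1)
  have "measure lborel ({a<..<b} \<inter> {s..t}) \<le> measure lborel {s..t}"
    by (rule measure_mono_fmeasurable) (auto simp: fmeasurable_def assms)
  then show "(LINT x|restrict_space lborel {a<..<b}. indicat_real {s..t} x) \<le> t - s"
    using assms by (simp add: measure_restrict_space Int_commute)
qed

text \<open>The density \<open>\<rho>\<close> has integral S b - S a = 1, so the integral is a
  weighted mean of values of u on {p<..<q}.\<close>

lemma weighted_mean_near:
  fixes u :: "real \<Rightarrow> real"
  assumes "continuous_on {a..b} u" "a \<le> p" "p < q" "q \<le> b"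
    and "\<And>x. x \<in> {p<..<q} \<Longrightarrow> \<bar>u x - z\<bar> \<le> \<delta>"
    and step: "smooth_step p q S \<rho>"
  shows "\<bar>(LINT x|restrict_space lborel {a<..<b}. u x * \<rho> x) - z\<bar> \<le> \<delta>"
proof -
  let ?R = "restrict_space lborel {a<..<b}"
  note S = smooth_stepD[OF step]
  have c\<rho>: "continuous_on {a..b} \<rho>"
    using S(3) continuous_on_subset by blast
  have "(LINT x|?R. \<rho> x) = S b - S a"
    by (rule FTC_open_interval) (use S(2) assms c\<rho> in auto)
  then have one: "(LINT x|?R. \<rho> x) = 1"
    using S(4)[of a] S(5)[of b] assms by simp
  have i: "integrable ?R \<rho>" "integrable ?R (\<lambda>x. u x * \<rho> x)"
    by (intro integrable_open_interval continuous_intros c\<rho> assms(1))+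
  have "(LINT x|?R. u x * \<rho> x) - z = (LINT x|?R. (u x - z) * \<rho> x)"
    using i one by (simp add: left_diff_distrib)
  also have "\<bar>\<dots>\<bar> \<le> (LINT x|?R. \<delta> * \<rho> x)"
  proof (rule integral_abs_bound_integral)
    show "integrable ?R (\<lambda>x. (u x - z) * \<rho> x)" "integrable ?R (\<lambda>x. \<delta> * \<rho> x)"
      using i by (auto simp: left_diff_distrib)
    show "\<bar>(u x - z) * \<rho> x\<bar> \<le> \<delta> * \<rho> x" for x
      using assms(5)[of x] S(6,7)[of x]
      by (cases "x \<in> {p<..<q}") (auto simp: abs_mult intro!: mult_right_mono)
  qed
  also have "\<dots> = \<delta>" using one by simp
  finally show ?thesis .
qed

text \<open>
  The weak derivative is tested against a smooth approximation of the indicator function of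
  \<open>{s..t}\<close>, whose derivative approximates the difference of the point masses at \<open>s\<close> and \<open>t\<close>.
\<close>

lemma weak_deriv_increment:
  fixes u :: "real \<Rightarrow> real"
  assumes u: "continuous_on {a..b} u" and v: "is_weak_deriv a b u v"
    and st: "a \<le> s" "s \<le> t" "t \<le> b"
  shows "(u t - u s)\<^sup>2 \<le> (t - s) * (LINT x|restrict_space lborel {a<..<b}. (v x)\<^sup>2)"
proof (cases "s = t")
  case False
  let ?R = "restrict_space lborel {a<..<b}"
  define Q where "Q = (LINT x|?R. (v x)\<^sup>2)"
  have Q0: "0 \<le> Q" by (simp add: Q_def)
  have v2: "v \<in> L2 ?R" using v by (simp add: is_weak_deriv_def)
  have "\<bar>u t - u s\<bar> \<le> sqrt ((t - s) * Q) + e" if "0 < e" for e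
  proof -
    define \<delta> where "\<delta> = e / 2"
    have \<delta>: "0 < \<delta>" using that by (simp add: \<delta>_def)
    obtain d1 where d1: "0 < d1" "\<And>x. x \<in> {a..b} \<Longrightarrow> dist x s < d1 \<Longrightarrow> dist (u x) (u s) < \<delta>"
      using u \<delta> st unfolding continuous_on_iff by (metis atLeastAtMost_iff order_trans)
    obtain d2 where d2: "0 < d2" "\<And>x. x \<in> {a..b} \<Longrightarrow> dist x t < d2 \<Longrightarrow> dist (u x) (u t) < \<delta>"
      using u \<delta> st unfolding continuous_on_iff by (metis atLeastAtMost_iff order_trans)
    \<comment> \<open>A quarter of the minimum places the two ramps {s+h..s+2h} and {t-2h..t-h} in
      order inside {s..t}, and close enough to s and t for the continuity estimates.\<close>
    define h where "h = min (t - s) (min d1 d2) / 4"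
    have h: "0 < h" "4 * h \<le> t - s" "4 * h \<le> d1" "4 * h \<le> d2"
      using False st d1 d2 by (auto simp: h_def)
    have lt: "s + h < s + 2 * h" "t - 2 * h < t - h" using h by auto
    obtain S1 \<rho>1 S2 \<rho>2 where step: "smooth_step (s + h) (s + 2 * h) S1 \<rho>1"
      "smooth_step (t - 2 * h) (t - h) S2 \<rho>2"
      using ex_smooth_step[OF lt(1)] ex_smooth_step[OF lt(2)] by blast
    note S1 = smooth_stepD[OF step(1)] and S2 = smooth_stepD[OF step(2)]
    define \<phi> where "\<phi> x = S1 x - S2 x" for x
    have \<phi>': "(\<phi> has_real_derivative \<rho>1 x - \<rho>2 x) (at x)" for x
      unfolding \<phi>_def by (intro derivative_intros S1 S2)
    have d\<phi>: "deriv \<phi> x = \<rho>1 x - \<rho>2 x" for x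
      using \<phi>' by (rule DERIV_imp_deriv)
    have mono: "S1 x \<le> S1 y" "S2 x \<le> S2 y" if "x \<le> y" for x y
      using that S1(2,6) S2(2,6) by (meson DERIV_nonneg_imp_nondecreasing)+
    have range: "0 \<le> S1 x" "S1 x \<le> 1" "0 \<le> S2 x" "S2 x \<le> 1" for x
      using mono[of "min x (s + h)" x] mono[of x "max x (s + 2 * h)"]
        mono[of "min x (t - 2 * h)" x] mono[of x "max x (t - h)"]
        S1(4)[of "min x (s + h)"] S1(5)[of "max x (s + 2 * h)"]
        S2(4)[of "min x (t - 2 * h)"] S2(5)[of "max x (t - h)"] by auto
    have \<phi>0: "\<phi> x = 0" if "x \<notin> {s + h..t - h}" for x
    proof (cases "x < s + h")
      case True
      then show ?thesis using S1(4)[of x] S2(4)[of x] h by (simp add: \<phi>_def)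
    next
      case False
      then show ?thesis using S1(5)[of x] S2(5)[of x] h that by (simp add: \<phi>_def)
    qed
    have \<phi>_sq: "(\<phi> x)\<^sup>2 \<le> indicat_real {s..t} x" for x
    proof (cases "x \<in> {s..t}")
      case True
      have "\<bar>\<phi> x\<bar> \<le> 1" using range[of x] by (auto simp: \<phi>_def)
      then show ?thesis using True by (simp add: abs_square_le_1)
    qed (use \<phi>0 h in auto)
    have c\<phi>: "continuous_on A \<phi>" for A
      by (rule DERIV_continuous_on) (rule has_field_derivative_at_within[OF \<phi>'])
    have "\<phi> \<in> test_functions a b"
    proof -
      have "smooth \<phi>" unfolding \<phi>_def by (intro smooth_diff S1 S2)
      moreover have "{s + h..t - h} \<subseteq> {a<..<b}" using st h by auto
      ultimately show ?thesis
        unfolding test_functions_def smooth_def using \<phi>0 compact_Icc by blast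
    qed
    then have "(LINT x|?R. u x * deriv \<phi> x) = - (LINT x|?R. v x * \<phi> x)"
      using v by (simp add: is_weak_deriv_def)
    moreover have "(LINT x|?R. u x * deriv \<phi> x) = (LINT x|?R. u x * \<rho>1 x) - (LINT x|?R. u x * \<rho>2 x)"
    proof -
      have "integrable ?R (\<lambda>x. u x * \<rho>1 x)" "integrable ?R (\<lambda>x. u x * \<rho>2 x)"
        by (intro integrable_open_interval continuous_intros u continuous_on_subset[OF S1(3)]
            continuous_on_subset[OF S2(3)] subset_UNIV)+
      then show ?thesis by (simp add: d\<phi> right_diff_distrib)
    qed
    moreover have "\<bar>(LINT x|?R. u x * \<rho>1 x) - u s\<bar> \<le> \<delta>"
      using u st h d1(2) step(1)
      by (intro weighted_mean_near[of _ _ _ "s + h" "s + 2 * h"])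
        (simp_all add: dist_real_def less_imp_le)
    moreover have "\<bar>(LINT x|?R. u x * \<rho>2 x) - u t\<bar> \<le> \<delta>"
      using u st h d2(2) step(2)
      by (intro weighted_mean_near[of _ _ _ "t - 2 * h" "t - h"])
        (simp_all add: dist_real_def less_imp_le)
    \<comment> \<open>Cauchy-Schwarz, where the square integral of \<open>\<phi>\<close> is at most
      t - s because \<open>\<phi>\<close> is bounded by 1 and vanishes outside {s..t}.\<close>
    moreover have "\<bar>LINT x|?R. v x * \<phi> x\<bar> \<le> sqrt ((t - s) * Q)"
    proof (rule real_le_rsqrt)
      have "\<bar>LINT x|?R. v x * \<phi> x\<bar>\<^sup>2 \<le> Q * (LINT x|?R. (\<phi> x)\<^sup>2)"
        using L2_Cauchy_Schwarz[OF v2 L2_open_interval[OF c\<phi>]] by (simp add: Q_def)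
      also have "\<dots> \<le> Q * (t - s)"
      proof (intro mult_left_mono Q0)
        have "(LINT x|?R. (\<phi> x)\<^sup>2) \<le> (LINT x|?R. indicat_real {s..t} x)"
          by (intro integral_mono integral_indicator_diff integrable_open_interval
              continuous_intros c\<phi> st \<phi>_sq)
        then show "(LINT x|?R. (\<phi> x)\<^sup>2) \<le> t - s"
          using integral_indicator_diff(2)[OF st] by linarith
      qed
      finally show "\<bar>LINT x|?R. v x * \<phi> x\<bar>\<^sup>2 \<le> (t - s) * Q" by (simp add: mult.commute)
    qed
    ultimately show ?thesis unfolding \<delta>_def by linarith
  qed
  then have "\<bar>u t - u s\<bar> \<le> sqrt ((t - s) * Q)"
    by (rule field_le_epsilon)
  then have "\<bar>u t - u s\<bar>\<^sup>2 \<le> (sqrt ((t - s) * Q))\<^sup>2"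
    by (rule power_mono) simp
  then show ?thesis
    using st Q0 by (simp add: Q_def)
qed simp

text \<open>Splitting the integrals requires each summand to be integrable; continuity of f and g
  ensures this for the products with \<open>deriv \<phi>\<close>.\<close>

lemma is_weak_deriv_linear:
  assumes f: "is_weak_deriv a b f f'" and g: "is_weak_deriv a b g g'"
    and cont: "continuous_on {a..b} f" "continuous_on {a..b} g"
  shows "is_weak_deriv a b (\<lambda>x. \<alpha> * f x + \<beta> * g x) (\<lambda>x. \<alpha> * f' x + \<beta> * g' x)"
  unfolding is_weak_deriv_def
proof (intro conjI ballI)
  let ?R = "restrict_space lborel {a<..<b}"
  have L: "f' \<in> L2 ?R" "g' \<in> L2 ?R"
    using f g by (auto simp: is_weak_deriv_def)
  then show "(\<lambda>x. \<alpha> * f' x + \<beta> * g' x) \<in> L2 ?R" by (rule L2_linear)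
  fix \<phi> assume \<phi>: "\<phi> \<in> test_functions a b"
  have D: "(deriv ^^ n) \<phi> differentiable at x" for n x
    using \<phi> by (auto simp: test_functions_def)
  have c: "continuous_on A ((deriv ^^ n) \<phi>)" for A n
    using D by (meson continuous_at_imp_continuous_on differentiable_imp_continuous_within)
  have "integrable ?R (\<lambda>x. f x * deriv \<phi> x)" "integrable ?R (\<lambda>x. g x * deriv \<phi> x)"
    using c[of _ 1] by (auto intro!: integrable_open_interval continuous_intros cont)
  moreover have "integrable ?R (\<lambda>x. f' x * \<phi> x)" "integrable ?R (\<lambda>x. g' x * \<phi> x)"
    using c[of _ 0] by (auto intro!: L2_integrable_mult L L2_open_interval)
  ultimately show "(LINT x|?R. (\<alpha> * f x + \<beta> * g x) * deriv \<phi> x) =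
      - (LINT x|?R. (\<alpha> * f' x + \<beta> * g' x) * \<phi> x)"
    using f g \<phi> by (simp add: is_weak_deriv_def distrib_right mult.assoc)
qed

section \<open>Increments of functions on a metric graph\<close>

text \<open>The parallelogram identity gives (x + y)^2 \<le> 2 x^2 + 2 y^2. Keeping \<open>Q\<close>
  as a common factor lets increment bounds be chained along a path.\<close>

lemma square_chain:
  fixes a b c :: real
  assumes "(a - b)\<^sup>2 \<le> K * Q" "(b - c)\<^sup>2 \<le> L * Q"
  shows "(a - c)\<^sup>2 \<le> 2 * (K + L) * Q"
proof -
  have "(a - c)\<^sup>2 + ((a - b) - (b - c))\<^sup>2 = 2 * (a - b)\<^sup>2 + 2 * (b - c)\<^sup>2"
    by (simp add: power2_eq_square algebra_simps)
  then have "(a - c)\<^sup>2 \<le> 2 * (a - b)\<^sup>2 + 2 * (b - c)\<^sup>2"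
    by (smt (verit) zero_le_power2)
  also have "\<dots> \<le> 2 * (K * Q) + 2 * (L * Q)" using assms by simp
  finally show ?thesis by (simp add: algebra_simps)
qed

context metric_graph
begin

section \<open>Continuity on the glued space\<close>

lemma edge_map_in_points:
  assumes "e \<in> arcs G"
  shows "edge_map G l e t \<in> points G l"
  using assms by (auto simp: edge_map_def points_def)

lemma edge_map_0 [simp]: "edge_map G l e 0 = Vertex (tail G e)"
  by (simp add: edge_map_def)

lemma edge_map_length: "e \<in> arcs G \<Longrightarrow> edge_map G l e (l e) = Vertex (head G e)"
  using length_pos[of e] by (simp add: edge_map_def)

lemma continuous_map_edge_map:
  assumes "e \<in> arcs G"
  shows "continuous_map (top_of_set {0..l e}) (graph_topology G l) (edge_map G l e)"
  using assms edge_map_in_points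
  by (auto simp: continuous_map_def topspace_graph_topology openin_graph_topology Pi_iff)

lemma continuous_on_edge:
  assumes "continuous_map (graph_topology G l) euclideanreal f" "e \<in> arcs G"
  shows "continuous_on {0..l e} (\<lambda>t. f (edge_map G l e t))"
  using continuous_map_compose[OF continuous_map_edge_map[OF assms(2)] assms(1)]
  by (simp add: o_def)

text \<open>This is the universal property of the quotient topology; the discrete vertex set adds no
  condition.\<close>

lemma continuous_map_graphI:
  fixes f :: "('v, 'e) point \<Rightarrow> real"
  assumes "\<And>e. e \<in> arcs G \<Longrightarrow> continuous_on {0..l e} (\<lambda>t. f (edge_map G l e t))"
  shows "continuous_map (graph_topology G l) euclideanreal f"
  unfolding continuous_map_def
proof (intro conjI allI impI)
  fix W :: "real set" assume "openin euclidean W"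
  then have W: "open W" by simp
  have "openin (top_of_set {0..l e}) {t \<in> {0..l e}. f (edge_map G l e t) \<in> W}"
    if "e \<in> arcs G" for e
    using continuous_openin_preimage_gen[OF assms[OF that] W] by (simp add: vimage_def Int_def)
  then show "openin (graph_topology G l) {x \<in> topspace (graph_topology G l). f x \<in> W}"
    by (auto simp: openin_graph_topology topspace_graph_topology edge_map_in_points)
qed simp

text \<open>The graph is covered by finitely many compact edge images and the finite vertex set. The
  vertices are listed separately to cover a graph without arcs.\<close>

lemma continuous_bounded:
  assumes "continuous_map (graph_topology G l) euclideanreal f"
  obtains B where "\<And>x. x \<in> points G l \<Longrightarrow> \<bar>f x\<bar> \<le> B"
proof -
  have "compact ((\<lambda>t. f (edge_map G l e t)) ` {0..l e})" if "e \<in> arcs G" for e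
    by (intro compact_continuous_image continuous_on_edge assms that) auto
  then have "bounded (f ` Vertex ` verts G \<union> (\<Union>e\<in>arcs G. (\<lambda>t. f (edge_map G l e t)) ` {0..l e}))"
    by (intro bounded_Un[THEN iffD2] conjI bounded_UN ballI)
      (auto intro: finite_imp_bounded compact_imp_bounded)
  moreover have "f ` points G l
      \<subseteq> f ` Vertex ` verts G \<union> (\<Union>e\<in>arcs G. (\<lambda>t. f (edge_map G l e t)) ` {0..l e})"
  proof
    fix y assume "y \<in> f ` points G l"
    then obtain x where x: "x \<in> points G l" "y = f x" by blast
    show "y \<in> f ` Vertex ` verts G \<union> (\<Union>e\<in>arcs G. (\<lambda>t. f (edge_map G l e t)) ` {0..l e})"
    proof (cases x)
      case (Inner e t)
      then have "e \<in> arcs G" "0 < t" "t < l e" using x by (auto simp: points_def)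
      then show ?thesis
        using x Inner by (auto simp: edge_map_def intro!: bexI[of _ e] image_eqI[of _ _ t])
    qed (use x in \<open>auto simp: points_def\<close>)
  qed
  ultimately have "bounded (f ` points G l)" by (rule bounded_subset)
  then show thesis using that unfolding bounded_iff by auto
qed

text \<open>
  The estimates below hold for every choice \<open>w\<close> of weak derivatives on the edges. For a linear
  combination of eigenfunctions \<open>w\<close> is taken to be the combination of their weak derivatives, so that
  the almost everywhere uniqueness of weak derivatives is never used.
\<close>

definition weak_gradient :: "(('v, 'e) point \<Rightarrow> real) \<Rightarrow> ('e \<Rightarrow> real \<Rightarrow> real) \<Rightarrow> bool" where
  "weak_gradient f w \<longleftrightarrow> continuous_map (graph_topology G l) euclideanreal f \<and>
     (\<forall>e\<in>arcs G. is_weak_deriv 0 (l e) (\<lambda>t. f (edge_map G l e t)) (w e))"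

text \<open>When \<open>w\<close> consists of the chosen \<open>weak_deriv\<close> of f on each
  edge, this is \<open>energy_form G l f f\<close>.\<close>

definition gradient_energy :: "('e \<Rightarrow> real \<Rightarrow> real) \<Rightarrow> real" where
  "gradient_energy w = (\<Sum>e\<in>arcs G. LINT t|restrict_space lborel {0<..<l e}. (w e t)\<^sup>2)"

lemma gradient_energy_nonneg: "0 \<le> gradient_energy w"
  unfolding gradient_energy_def by (intro sum_nonneg integral_nonneg) auto

lemma weak_gradient_linear:
  assumes "weak_gradient f v" "weak_gradient g w"
  shows "weak_gradient (\<lambda>x. \<alpha> * f x + \<beta> * g x) (\<lambda>e t. \<alpha> * v e t + \<beta> * w e t)"
  using assms unfolding weak_gradient_def
  by (auto intro!: continuous_intros is_weak_deriv_linear continuous_on_edge)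

lemma edge_increment:
  assumes f: "weak_gradient f w" and e: "e \<in> arcs G" and st: "s \<in> {0..l e}" "t \<in> {0..l e}"
  shows "(f (edge_map G l e t) - f (edge_map G l e s))\<^sup>2 \<le> \<bar>t - s\<bar> * gradient_energy w"
proof -
  let ?I = "LINT t|restrict_space lborel {0<..<l e}. (w e t)\<^sup>2"
  have le: "?I \<le> gradient_energy w"
    unfolding gradient_energy_def using e by (intro member_le_sum integral_nonneg) auto
  have *: "(f (edge_map G l e q) - f (edge_map G l e p))\<^sup>2 \<le> (q - p) * ?I"
    if "0 \<le> p" "p \<le> q" "q \<le> l e" for p q
    using weak_deriv_increment[OF continuous_on_edge, of f e "w e" p q] f e that
    by (auto simp: weak_gradient_def)
  have "(f (edge_map G l e t) - f (edge_map G l e s))\<^sup>2 \<le> \<bar>t - s\<bar> * ?I"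
    using *[of s t] *[of t s] st
    by (cases "s \<le> t") (auto simp: power2_commute[of "f (edge_map G l e t)"])
  also have "\<dots> \<le> \<bar>t - s\<bar> * gradient_energy w"
    using le by (intro mult_left_mono) auto
  finally show ?thesis .
qed

text \<open>Connectedness gives an undirected path from u to v. Each arc, crossed in either
  direction, contributes its length, and \<open>square_chain\<close> updates the constant
  independently of f and w.\<close>

lemma vertex_increment:
  assumes "u \<in> verts G" "v \<in> verts G"
  shows "\<exists>K\<ge>0. \<forall>f w. weak_gradient f w \<longrightarrow>
    (f (Vertex u) - f (Vertex v))\<^sup>2 \<le> K * gradient_energy w"
proof -
  have "(u, v) \<in> rtrancl_on (verts G) (parcs (mk_symmetric G))"
    using connected assms
    by (auto simp: Digraph_Component.connected_def strongly_connected_def reachable_def)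
  then show ?thesis
  proof (induction rule: rtrancl_on_induct)
    case base
    then show ?case by (auto intro!: exI[of _ 0])
  next
    case (step x y)
    then obtain K where K: "0 \<le> K"
      "\<And>f w. weak_gradient f w \<Longrightarrow> (f (Vertex u) - f (Vertex x))\<^sup>2 \<le> K * gradient_energy w"
      by blast
    from step(2) obtain e where e: "e \<in> arcs G"
      "(x, y) = (tail G e, head G e) \<or> (x, y) = (head G e, tail G e)"
      by (auto simp: parcs_mk_symmetric)
    have "(f (Vertex x) - f (Vertex y))\<^sup>2 \<le> l e * gradient_energy w" if "weak_gradient f w" for f w
      using edge_increment[OF that e(1), of 0 "l e"] length_pos[OF e(1)] e
      by (auto simp: edge_map_length power2_commute)
    then have "(f (Vertex u) - f (Vertex y))\<^sup>2 \<le> (2 * (K + l e)) * gradient_energy w"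
      if "weak_gradient f w" for f w
      using that K square_chain by metis
    moreover have "0 \<le> 2 * (K + l e)" using K length_pos[OF e(1)] by simp
    ultimately show ?case by blast
  qed
qed

text \<open>An inner point is compared with the tail of its edge. The total length is a constant
  that serves all points at once.\<close>

lemma vertex_near:
  assumes "x \<in> points G l"
  shows "\<exists>u\<in>verts G. \<forall>f w. weak_gradient f w \<longrightarrow>
    (f x - f (Vertex u))\<^sup>2 \<le> (\<Sum>e\<in>arcs G. l e) * gradient_energy w"
proof (cases x)
  case (Vertex u)
  have "0 \<le> (\<Sum>e\<in>arcs G. l e)" by (intro sum_nonneg less_imp_le length_pos)
  then show ?thesis
    using Vertex assms gradient_energy_nonneg
    by (intro bexI[of _ u]) (auto simp: points_def mult_nonneg_nonneg)
next
  case (Inner e t)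
  then have t: "e \<in> arcs G" "0 < t" "t < l e" using assms by (auto simp: points_def)
  have "(f x - f (Vertex (tail G e)))\<^sup>2 \<le> (\<Sum>e\<in>arcs G. l e) * gradient_energy w"
    if "weak_gradient f w" for f w
  proof -
    have "(f x - f (Vertex (tail G e)))\<^sup>2 \<le> t * gradient_energy w"
      using edge_increment[OF that t(1), of 0 t] t Inner by (simp add: edge_map_def)
    also have "\<dots> \<le> (\<Sum>e\<in>arcs G. l e) * gradient_energy w"
    proof (rule mult_right_mono[OF _ gradient_energy_nonneg])
      have "l e \<le> (\<Sum>e\<in>arcs G. l e)"
        using t by (intro member_le_sum less_imp_le length_pos) auto
      then show "t \<le> (\<Sum>e\<in>arcs G. l e)" using t by simp
    qed
    finally show ?thesis .
  qed
  then show ?thesis using t by (intro bexI[of _ "tail G e"]) auto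
qed

text \<open>Any two points are joined through nearby vertices. There are finitely many vertex pairs,
  so one constant serves them all.\<close>

lemma point_increment:
  shows "\<exists>K\<ge>0. \<forall>x\<in>points G l. \<forall>y\<in>points G l. \<forall>f w. weak_gradient f w \<longrightarrow>
    (f x - f y)\<^sup>2 \<le> K * gradient_energy w"
proof -
  define L where "L = (\<Sum>e\<in>arcs G. l e)"
  have L0: "0 \<le> L" unfolding L_def by (intro sum_nonneg less_imp_le length_pos)
  from vertex_increment obtain C where C: "\<And>u v. u \<in> verts G \<Longrightarrow> v \<in> verts G \<Longrightarrow> 0 \<le> C u v"
    "\<And>u v f w. u \<in> verts G \<Longrightarrow> v \<in> verts G \<Longrightarrow> weak_gradient f w \<Longrightarrow>
      (f (Vertex u) - f (Vertex v))\<^sup>2 \<le> C u v * gradient_energy w"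
    by metis
  \<comment> \<open>The constants are nonnegative, so their sum dominates each of them.\<close>
  define K where "K = (\<Sum>u\<in>verts G. \<Sum>v\<in>verts G. C u v)"
  have CK: "C u v \<le> K" if "u \<in> verts G" "v \<in> verts G" for u v
  proof -
    have "C u v \<le> (\<Sum>v\<in>verts G. C u v)"
      using that C by (intro member_le_sum) auto
    also have "\<dots> \<le> K"
      unfolding K_def using that C by (intro member_le_sum sum_nonneg) auto
    finally show ?thesis .
  qed
  have K0: "0 \<le> K" unfolding K_def by (intro sum_nonneg C)
  have "(f x - f y)\<^sup>2 \<le> 2 * (2 * (L + K) + L) * gradient_energy w"
    if xy: "x \<in> points G l" "y \<in> points G l" and f: "weak_gradient f w" for x y f w
  proof -
    obtain u where u: "u \<in> verts G" "(f x - f (Vertex u))\<^sup>2 \<le> L * gradient_energy w"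
      using vertex_near[OF xy(1)] f unfolding L_def by blast
    obtain v where v: "v \<in> verts G" "(f (Vertex v) - f y)\<^sup>2 \<le> L * gradient_energy w"
      using vertex_near[OF xy(2)] f power2_commute unfolding L_def by metis
    have "(f (Vertex u) - f (Vertex v))\<^sup>2 \<le> K * gradient_energy w"
      using C(2)[OF u(1) v(1) f] mult_right_mono[OF CK[OF u(1) v(1)] gradient_energy_nonneg[of w]]
      by linarith
    from square_chain[OF square_chain[OF u(2) this] v(2)] show ?thesis .
  qed
  moreover have "0 \<le> 2 * (2 * (L + K) + L)" using K0 L0 by simp
  ultimately show ?thesis by blast
qed

text \<open>
  Only continuity of \<open>D\<close> and \<open>D x0 = 0\<close> matter below, so away from the edge containing
  \<open>x0\<close> a crude constant replaces the path distance.
\<close>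

lemma ex_modulus:
  "\<exists>x0\<in>points G l. \<exists>D. continuous_map (graph_topology G l) euclideanreal D \<and> D x0 = 0 \<and>
    (\<forall>f w. weak_gradient f w \<longrightarrow> (\<forall>x\<in>points G l. (f x - f x0)\<^sup>2 \<le> D x * gradient_energy w))"
proof -
  obtain K where K: "0 \<le> K" "\<And>x y f w. x \<in> points G l \<Longrightarrow> y \<in> points G l \<Longrightarrow>
      weak_gradient f w \<Longrightarrow> (f x - f y)\<^sup>2 \<le> K * gradient_energy w"
    using point_increment by blast
  show ?thesis
  \<comment> \<open>Without arcs every function is continuous, so \<open>D\<close> may jump from 0
    to \<open>K\<close>.\<close>
  proof (cases "arcs G = {}")
    case True
    have "verts G \<noteq> {}"
      using connected by (simp add: Digraph_Component.connected_def strongly_connected_def)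
    then obtain v where "Vertex v \<in> points G l" by (auto simp: points_def)
    moreover have "continuous_map (graph_topology G l) euclideanreal (\<lambda>x. if x = Vertex v then 0 else K)"
      using True by (intro continuous_map_graphI) simp
    ultimately show ?thesis
      using K(2) by (intro bexI exI[of _ "\<lambda>x. if x = Vertex v then 0 else K"]) auto
  next
    case False
    then obtain e where e: "e \<in> arcs G" by blast
    define h where "h = l e"
    have h: "0 < h" using length_pos[OF e] by (simp add: h_def)
    \<comment> \<open>The summand \<open>K\<close> covers points off the edge \<open>e\<close>; the
      summand \<open>h\<close> gives C/h \<ge> 1, which covers points on it.\<close>
    define C where "C = K + h"
    \<comment> \<open>On \<open>e\<close> this is V-shaped: 0 at the midpoint and \<open>C\<close>
      at both ends, where it matches the constant value used elsewhere.\<close>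
    define D where "D x = (case x of Vertex u \<Rightarrow> C
        | Inner e' t \<Rightarrow> if e' = e then C * \<bar>2 * t - h\<bar> / h else C)" for x :: "('v, 'e) point"
    have De: "D (edge_map G l e t) = C * \<bar>2 * t - h\<bar> / h" if "t \<in> {0..h}" for t
      using that h by (auto simp: D_def edge_map_def h_def)
    have De': "D (edge_map G l e' t) = C" if "e' \<noteq> e" for e' t
      using that by (auto simp: D_def edge_map_def)
    let ?x = "Inner e (h / 2)"
    have x: "?x \<in> points G l" "?x = edge_map G l e (h / 2)"
      using e h edge_map_in_points[OF e, of "h / 2"] by (auto simp: edge_map_def h_def)
    have "continuous_map (graph_topology G l) euclideanreal D"
    proof (rule continuous_map_graphI)
      fix e' assume "e' \<in> arcs G"
      show "continuous_on {0..l e'} (\<lambda>t. D (edge_map G l e' t))"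
      proof (cases "e' = e")
        case True
        have "continuous_on {0..h} (\<lambda>t. C * \<bar>2 * t - h\<bar> / h)"
          using h by (intro continuous_intros) auto
        then show ?thesis using True De h_def by (metis (no_types, lifting) continuous_on_cong)
      qed (simp add: De')
    qed
    moreover have "D ?x = 0" by (simp add: D_def)
    moreover have "(f y - f ?x)\<^sup>2 \<le> D y * gradient_energy w"
      if f: "weak_gradient f w" and y: "y \<in> points G l" for f w y
    proof (cases "\<exists>t. y = Inner e t")
      case True
      then obtain t where t: "y = Inner e t" "0 < t" "t < h"
        using y by (auto simp: points_def h_def)
      then have yt: "y = edge_map G l e t" by (simp add: edge_map_def h_def)
      have "(f y - f ?x)\<^sup>2 \<le> \<bar>t - h / 2\<bar> * gradient_energy w"
        unfolding x(2) yt using t h by (intro edge_increment[OF f e]) (auto simp: h_def)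
      also have "\<dots> \<le> D y * gradient_energy w"
      proof (rule mult_right_mono[OF _ gradient_energy_nonneg])
        have "h * \<bar>t - h / 2\<bar> \<le> C * \<bar>2 * t - h\<bar>"
          using K(1) h unfolding C_def by (intro mult_mono) auto
        then show "\<bar>t - h / 2\<bar> \<le> D y"
          using h t by (simp add: D_def field_simps)
      qed
      finally show ?thesis .
    next
      case False
      then have Dy: "D y = C" by (auto simp: D_def split: point.splits)
      show ?thesis
        using K(2)[OF y x(1) f] mult_nonneg_nonneg[OF less_imp_le[OF h] gradient_energy_nonneg[of w]]
        unfolding Dy C_def distrib_right by linarith
    qed
    ultimately show ?thesis using x(1) by blast
  qed
qed

end

section \<open>Measures close to a point mass\<close>

context metric_graph
begin

lemma prob_measuresD:
  assumes "\<mu> \<in> prob_measures G l"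
  shows "prob_space \<mu>" "space \<mu> = points G l"
    "sets \<mu> = sigma_sets (points G l) {U. openin (graph_topology G l) U}"
proof -
  have sub: "{U. openin (graph_topology G l) U} \<subseteq> Pow (points G l)"
    using openin_subset by (force simp: topspace_graph_topology)
  show "prob_space \<mu>" using assms by (simp add: prob_measures_def)
  show "sets \<mu> = sigma_sets (points G l) {U. openin (graph_topology G l) U}"
    using assms sub by (simp add: prob_measures_def sets_measure_of)
  show "space \<mu> = points G l"
    using assms sub sets_eq_imp_space_eq[of \<mu> "sigma (points G l) {U. openin (graph_topology G l) U}"]
    by (simp add: prob_measures_def space_measure_of)
qed

lemma continuous_integrable:
  assumes \<mu>: "\<mu> \<in> prob_measures G l"
    and f: "continuous_map (graph_topology G l) euclideanreal f"
  shows "integrable \<mu> f"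
proof -
  interpret prob_space \<mu> using prob_measuresD[OF \<mu>] by simp
  have "f \<in> borel_measurable \<mu>"
  proof (rule borel_measurableI)
    fix S :: "real set" assume "open S"
    then have "openin (graph_topology G l) {x \<in> points G l. f x \<in> S}"
      using f by (auto simp: continuous_map_def topspace_graph_topology)
    then show "f -` S \<inter> space \<mu> \<in> sets \<mu>"
      unfolding prob_measuresD[OF \<mu>]
      by (intro sigma_sets.Basic) (simp add: vimage_def Int_def conj_commute)
  qed
  moreover obtain B where "\<And>x. x \<in> points G l \<Longrightarrow> \<bar>f x\<bar> \<le> B"
    using continuous_bounded[OF f] by blast
  ultimately show ?thesis
    by (intro integrable_const_bound[of _ B]) (auto simp: prob_measuresD[OF \<mu>])
qed

text \<open>The point mass at x integrates \<open>D\<close> to D x < \<epsilon>, so it lies in a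
  subbasic open set defined by this inequality, and density puts a member of \<open>M\<close> into
  that set.\<close>

lemma weak_star_dense_near_point:
  assumes M: "M \<subseteq> prob_measures G l" "weak_star_topology G l closure_of M = prob_measures G l"
    and x: "x \<in> points G l" and D: "continuous_map (graph_topology G l) euclideanreal D"
    and "D x < \<epsilon>"
  shows "\<exists>\<mu>\<in>M. (LINT y|\<mu>. D y) < \<epsilon>"
proof -
  let ?S = "sigma (points G l) {U. openin (graph_topology G l) U}"
  let ?\<delta> = "return ?S x"
  have sub: "{U. openin (graph_topology G l) U} \<subseteq> Pow (points G l)"
    using openin_subset by (force simp: topspace_graph_topology)
  have x': "x \<in> space ?S" using x sub by (simp add: space_measure_of)
  have \<delta>: "?\<delta> \<in> prob_measures G l"
    using prob_space_return[OF x'] by (simp add: prob_measures_def)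
  have "D \<in> borel_measurable ?\<delta>"
    using continuous_integrable[OF \<delta> D] by (rule borel_measurable_integrable)
  then have "(LINT y|?\<delta>. D y) = D x"
    using x' by (intro integral_return) auto
  let ?W = "{\<mu> \<in> prob_measures G l. (LINT y|\<mu>. D y) \<in> {..<\<epsilon>}}"
  have "openin (weak_star_topology G l) ?W"
    unfolding weak_star_topology_def
    by (rule topology_generated_by_Basis, rule CollectI, rule exI[of _ D], rule exI[of _ "{..<\<epsilon>}"])
      (simp add: D)
  moreover have "?\<delta> \<in> ?W"
    using \<delta> \<open>(LINT y|?\<delta>. D y) = D x\<close> assms(5) by simp
  moreover have "\<forall>T. ?\<delta> \<in> T \<and> openin (weak_star_topology G l) T \<longrightarrow> (\<exists>\<mu>. \<mu> \<in> M \<and> \<mu> \<in> T)"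
    using \<delta> unfolding M(2)[symmetric] in_closure_of by (rule conjunct2)
  ultimately obtain \<mu> where "\<mu> \<in> M" "\<mu> \<in> ?W"
    by meson
  then show ?thesis by auto
qed

text \<open>For mean zero, the integral of (f - c)^2 is that of f^2 plus c^2, so any comparison
  value c is allowed; it will be the value of f at \<open>x0\<close>.\<close>

lemma poincare:
  assumes \<mu>: "\<mu> \<in> prob_measures G l" and f: "weak_gradient f w"
    and D: "continuous_map (graph_topology G l) euclideanreal D"
    and bound: "\<And>x. x \<in> points G l \<Longrightarrow> (f x - c)\<^sup>2 \<le> D x * gradient_energy w"
    and mean: "(LINT x|\<mu>. f x) = 0"
  shows "(LINT x|\<mu>. (f x)\<^sup>2) \<le> (LINT x|\<mu>. D x) * gradient_energy w"
proof -
  interpret prob_space \<mu> using prob_measuresD[OF \<mu>] by simp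
  have cf: "continuous_map (graph_topology G l) euclideanreal f"
    using f by (simp add: weak_gradient_def)
  have i: "integrable \<mu> f" "integrable \<mu> (\<lambda>x. (f x)\<^sup>2)" "integrable \<mu> D"
    "integrable \<mu> (\<lambda>x. (f x - c)\<^sup>2)"
    by (intro continuous_integrable[OF \<mu>] cf D continuous_intros)+
  have "(LINT x|\<mu>. (f x)\<^sup>2) \<le> (LINT x|\<mu>. (f x)\<^sup>2 - 2 * c * f x + c\<^sup>2)"
    using i mean by (simp add: prob_space)
  also have "\<dots> = (LINT x|\<mu>. (f x - c)\<^sup>2)"
    by (simp add: power2_diff algebra_simps)
  also have "\<dots> \<le> (LINT x|\<mu>. D x * gradient_energy w)"
    using i bound by (intro integral_mono) (auto simp: prob_measuresD[OF \<mu>])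
  finally show ?thesis using i by simp
qed

section \<open>Energy and orthogonality of eigenfunctions\<close>

lemma H1_weak_gradient:
  assumes "f \<in> H1 G l"
  shows "weak_gradient f (\<lambda>e. weak_deriv 0 (l e) (\<lambda>t. f (edge_map G l e t)))"
  unfolding weak_gradient_def
proof (intro conjI ballI)
  show "continuous_map (graph_topology G l) euclideanreal f"
    using assms by (simp add: H1_def)
  fix e assume "e \<in> arcs G"
  then have "\<exists>v. is_weak_deriv 0 (l e) (\<lambda>t. f (edge_map G l e t)) v"
    using assms by (simp add: H1_def H1_interval_def)
  then show "is_weak_deriv 0 (l e) (\<lambda>t. f (edge_map G l e t))
      (weak_deriv 0 (l e) (\<lambda>t. f (edge_map G l e t)))"
    unfolding weak_deriv_def by (rule someI_ex)
qed

lemma gradient_energy_linear: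
  assumes "f \<in> H1 G l" "g \<in> H1 G l"
  shows "gradient_energy (\<lambda>e t. \<alpha> * weak_deriv 0 (l e) (\<lambda>t. f (edge_map G l e t)) t
      + \<beta> * weak_deriv 0 (l e) (\<lambda>t. g (edge_map G l e t)) t)
    = \<alpha>\<^sup>2 * energy_form G l f f + 2 * \<alpha> * \<beta> * energy_form G l f g + \<beta>\<^sup>2 * energy_form G l g g"
proof -
  have "weak_deriv 0 (l e) (\<lambda>t. f (edge_map G l e t)) \<in> L2 (restrict_space lborel {0<..<l e})"
    "weak_deriv 0 (l e) (\<lambda>t. g (edge_map G l e t)) \<in> L2 (restrict_space lborel {0<..<l e})"
    if "e \<in> arcs G" for e
    using that assms[THEN H1_weak_gradient] by (auto simp: weak_gradient_def is_weak_deriv_def)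
  then show ?thesis
    by (simp add: gradient_energy_def energy_form_def L2_integral_linear_square
        sum.distrib sum_distrib_left)
qed

lemma energy_form_commute: "energy_form G l f g = energy_form G l g f"
  by (simp add: energy_form_def mult.commute)

text \<open>Being an eigenfunction puts g into \<open>H1_measure\<close>, so it may be used as a
  test function in the equation for f.\<close>

lemma eigenspace_energy:
  assumes "f \<in> eigenspace G l \<mu> r" "g \<in> eigenspace G l \<mu> s"
  shows "energy_form G l f g = r * (LINT x|\<mu>. f x * g x)"
  using assms by (auto simp: eigenspace_def operator_graph_def mult.assoc)

lemma eigenspace_H1: "f \<in> eigenspace G l \<mu> r \<Longrightarrow> f \<in> H1 G l"
  by (auto simp: eigenspace_def operator_graph_def H1_measure_def)

text \<open>By symmetry of the energy form, r and s times the same integral agree.\<close>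

lemma eigenspace_orthogonal:
  assumes "f \<in> eigenspace G l \<mu> r" "g \<in> eigenspace G l \<mu> s" "r \<noteq> s"
  shows "(LINT x|\<mu>. f x * g x) = 0"
  using eigenspace_energy[OF assms(1,2)] eigenspace_energy[OF assms(2,1)] assms(3)
    energy_form_commute[of f g] by (simp add: mult.commute)

lemma H1_integrable_mult:
  assumes "\<mu> \<in> prob_measures G l" "f \<in> H1 G l" "g \<in> H1 G l"
  shows "integrable \<mu> (\<lambda>x. f x * g x)"
  using assms by (auto intro!: continuous_integrable continuous_intros simp: H1_def)

lemma independent_eigenfunctions_bound:
  assumes \<mu>: "\<mu> \<in> prob_measures G l"
    and D: "continuous_map (graph_topology G l) euclideanreal D"
    and bound: "\<And>f w x. weak_gradient f w \<Longrightarrow> x \<in> points G l \<Longrightarrow>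
      (f x - f x0)\<^sup>2 \<le> D x * gradient_energy w"
    and f: "f \<in> eigenspace G l \<mu> r" and g: "g \<in> eigenspace G l \<mu> s"
    and rs: "r \<le> t" "s \<le> t" "0 \<le> t"
    and D0: "0 \<le> (LINT x|\<mu>. D x)"
    and indep: "\<And>\<alpha> \<beta>. AE x in \<mu>. \<alpha> * f x + \<beta> * g x = 0 \<Longrightarrow> \<alpha> = 0 \<and> \<beta> = 0"
  shows "1 \<le> t * (LINT x|\<mu>. D x)"
proof (rule ccontr)
  assume small: "\<not> 1 \<le> t * (LINT x|\<mu>. D x)"
  have H: "f \<in> H1 G l" "g \<in> H1 G l" using f g by (auto intro: eigenspace_H1)
  have i: "integrable \<mu> f" "integrable \<mu> g"
    using H by (auto intro: continuous_integrable[OF \<mu>] simp: H1_def)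
  \<comment> \<open>Mean zero is one linear equation in two unknowns, so it has a nontrivial
    solution.\<close>
  obtain \<alpha> \<beta> where ab: "\<alpha> \<noteq> 0 \<or> \<beta> \<noteq> 0" "\<alpha> * (LINT x|\<mu>. f x) + \<beta> * (LINT x|\<mu>. g x) = 0"
  proof (cases "(LINT x|\<mu>. g x) = 0")
    case True
    then show thesis using that[of 0 1] by simp
  next
    case False
    then show thesis using that[of "LINT x|\<mu>. g x" "- (LINT x|\<mu>. f x)"] by simp
  qed
  define h where "h x = \<alpha> * f x + \<beta> * g x" for x
  define w where "w e t = \<alpha> * weak_deriv 0 (l e) (\<lambda>t. f (edge_map G l e t)) t
      + \<beta> * weak_deriv 0 (l e) (\<lambda>t. g (edge_map G l e t)) t" for e t
  have hw: "weak_gradient h w"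
    unfolding h_def w_def by (intro weak_gradient_linear H1_weak_gradient H)
  define A B C where "A = (LINT x|\<mu>. f x * f x)" and "B = (LINT x|\<mu>. f x * g x)"
    and "C = (LINT x|\<mu>. g x * g x)"
  have h2: "(LINT x|\<mu>. (h x)\<^sup>2) = \<alpha>\<^sup>2 * A + 2 * \<alpha> * \<beta> * B + \<beta>\<^sup>2 * C"
    unfolding h_def A_def B_def C_def
    using H1_integrable_mult[OF \<mu>] H i \<mu>
    by (intro L2_integral_linear_square) (auto simp: L2_def power2_eq_square)
  have "gradient_energy w = \<alpha>\<^sup>2 * (r * A) + 2 * \<alpha> * \<beta> * (r * B) + \<beta>\<^sup>2 * (s * C)"
    unfolding w_def gradient_energy_linear[OF H] A_def B_def C_def
      eigenspace_energy[OF f f] eigenspace_energy[OF f g] eigenspace_energy[OF g g] ..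
  also have "\<dots> \<le> t * (LINT x|\<mu>. (h x)\<^sup>2)"
  \<comment> \<open>For equal eigenvalues the energy is exactly r times the square integral of h;
    for different ones orthogonality removes the mixed term, and the squares are compared
    separately.\<close>
  proof (cases "r = s")
    case True
    have "\<alpha>\<^sup>2 * (r * A) + 2 * \<alpha> * \<beta> * (r * B) + \<beta>\<^sup>2 * (s * C) = r * (LINT x|\<mu>. (h x)\<^sup>2)"
      unfolding h2 True by (simp add: algebra_simps)
    also have "\<dots> \<le> t * (LINT x|\<mu>. (h x)\<^sup>2)"
      using rs by (intro mult_right_mono) auto
    finally show ?thesis .
  next
    case False
    have "B = 0" unfolding B_def using f g False by (rule eigenspace_orthogonal)
    moreover have "r * (\<alpha>\<^sup>2 * A) \<le> t * (\<alpha>\<^sup>2 * A)" "s * (\<beta>\<^sup>2 * C) \<le> t * (\<beta>\<^sup>2 * C)"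
      using rs by (auto simp: A_def C_def intro!: mult_right_mono mult_nonneg_nonneg)
    ultimately show ?thesis unfolding h2 by (simp add: algebra_simps)
  qed
  finally have E: "gradient_energy w \<le> t * (LINT x|\<mu>. (h x)\<^sup>2)" .
  have "(LINT x|\<mu>. h x) = 0" unfolding h_def using ab i by simp
  then have "(LINT x|\<mu>. (h x)\<^sup>2) \<le> (LINT x|\<mu>. D x) * gradient_energy w"
    using bound[OF hw] by (intro poincare[OF \<mu> hw D])
  also have "\<dots> \<le> (LINT x|\<mu>. D x) * (t * (LINT x|\<mu>. (h x)\<^sup>2))"
    using E D0 by (intro mult_left_mono)
  finally have "(1 - t * (LINT x|\<mu>. D x)) * (LINT x|\<mu>. (h x)\<^sup>2) \<le> 0"
    by (simp add: algebra_simps)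
  then have "(LINT x|\<mu>. (h x)\<^sup>2) \<le> 0"
    using small by (simp add: mult_le_0_iff not_le)
  then have "(LINT x|\<mu>. (h x)\<^sup>2) = 0"
    by (intro antisym) auto
  moreover have "integrable \<mu> (\<lambda>x. (h x)\<^sup>2)"
    using hw by (intro continuous_integrable[OF \<mu>] continuous_intros) (simp add: weak_gradient_def)
  ultimately have "AE x in \<mu>. (h x)\<^sup>2 = 0"
    by (subst (asm) integral_nonneg_eq_0_iff_AE) auto
  then have "AE x in \<mu>. \<alpha> * f x + \<beta> * g x = 0" by (simp add: h_def)
  then show False using indep ab by blast
qed

end

section \<open>From the eigenvalue count to independent eigenfunctions\<close>

lemma L2_independent_mono:
  assumes "L2_independent \<mu> n F" "m \<le> n"
  shows "L2_independent \<mu> m F"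
  unfolding L2_independent_def
proof (intro allI impI)
  fix c i assume c: "AE x in \<mu>. (\<Sum>i<m. c i * F i x) = 0" and i: "i < m"
  define c' where "c' j = (if j < m then c j else 0)" for j
  have "(\<Sum>j<n. c' j * F j x) = (\<Sum>j<m. c j * F j x)" for x
    using assms(2) by (intro sum.mono_neutral_cong_right) (auto simp: c'_def)
  then have "\<forall>j<n. c' j = 0"
    using assms(1) c by (simp add: L2_independent_def)
  then have "c' i = 0" using i assms(2) by simp
  then show "c i = 0" using i by (simp add: c'_def)
qed

text \<open>Some independent family has more than m members, even if the dimension is infinite; it
  is cut down to its first m + 1.\<close>

lemma L2_dim_greater:
  assumes "enat m < L2_dim \<mu> S"
  shows "\<exists>F. (\<forall>i<Suc m. F i \<in> S) \<and> L2_independent \<mu> (Suc m) F"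
proof -
  obtain n F where "enat m < enat n" "\<forall>i<n. F i \<in> S" "L2_independent \<mu> n F"
    using assms unfolding L2_dim_def less_Sup_iff by blast
  then show ?thesis
    using L2_independent_mono[of \<mu> n F "Suc m"] by (intro exI[of _ F]) auto
qed

lemma sum_enat_gt_1:
  fixes d :: "'a \<Rightarrow> enat"
  assumes "1 < sum d A" "\<And>x. x \<in> A \<Longrightarrow> d x \<le> 1"
  obtains x y where "x \<in> A" "y \<in> A" "x \<noteq> y" "0 < d x" "0 < d y"
proof -
  \<comment> \<open>A sum over an infinite set is 0 by convention.\<close>
  have "finite A" using assms(1) by (metis not_less_zero sum.infinite)
  obtain x where x: "x \<in> A" "d x \<noteq> 0"
    using assms(1) by (metis not_less_zero sum.neutral)
  have "\<exists>y\<in>A - {x}. d y \<noteq> 0"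
  proof (rule ccontr)
    assume "\<not> (\<exists>y\<in>A - {x}. d y \<noteq> 0)"
    then have "sum d (A - {x}) = 0" by (intro sum.neutral) auto
    then have "sum d A = d x"
      using sum.remove[OF \<open>finite A\<close> x(1), of d] by simp
    then show False using assms x(1) by (metis leD)
  qed
  then show thesis using x that[of x] by auto
qed

text \<open>Either one eigenspace has dimension at least 2, or two different eigenvalues have
  nonzero eigenfunctions, which are independent by orthogonality.\<close>

lemma (in metric_graph) eigenvalue_count_gt_1:
  assumes \<mu>: "\<mu> \<in> prob_measures G l" and "1 < eigenvalue_count G l \<mu> t"
  shows "\<exists>r\<le>t. \<exists>s\<le>t. \<exists>f\<in>eigenspace G l \<mu> r. \<exists>g\<in>eigenspace G l \<mu> s.
    \<forall>\<alpha> \<beta>. (AE x in \<mu>. \<alpha> * f x + \<beta> * g x = 0) \<longrightarrow> \<alpha> = 0 \<and> \<beta> = 0"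
proof -
  obtain A where A: "finite A" "A \<subseteq> {..t}" "1 < (\<Sum>r\<in>A. L2_dim \<mu> (eigenspace G l \<mu> r))"
    using assms(2) unfolding eigenvalue_count_def less_Sup_iff by blast
  show ?thesis
  proof (cases "\<exists>r\<in>A. 1 < L2_dim \<mu> (eigenspace G l \<mu> r)")
    case True
    then obtain r where r: "r \<in> A" "enat 1 < L2_dim \<mu> (eigenspace G l \<mu> r)"
      by (auto simp: one_enat_def)
    then obtain F where F: "\<forall>i<Suc 1. F i \<in> eigenspace G l \<mu> r" "L2_independent \<mu> (Suc 1) F"
      using L2_dim_greater by blast
    have "\<alpha> = 0 \<and> \<beta> = 0" if "AE x in \<mu>. \<alpha> * F 0 x + \<beta> * F 1 x = 0" for \<alpha> \<beta>
    proof -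
      define c where "c i = (if i = 0 then \<alpha> else \<beta>)" for i :: nat
      have "AE x in \<mu>. (\<Sum>i<Suc 1. c i * F i x) = 0"
        using that by (simp add: c_def)
      then have "\<forall>i<Suc 1. c i = 0"
        using F(2) unfolding L2_independent_def by blast
      then have "c 0 = 0" "c 1 = 0" by auto
      then show ?thesis by (simp add: c_def)
    qed
    moreover have "F 0 \<in> eigenspace G l \<mu> r" "F 1 \<in> eigenspace G l \<mu> r" "r \<le> t"
      using F(1) r(1) A(2) by auto
    ultimately show ?thesis by blast
  next
    case False
    then obtain r s where rs: "r \<in> A" "s \<in> A" "r \<noteq> s"
      "0 < L2_dim \<mu> (eigenspace G l \<mu> r)" "0 < L2_dim \<mu> (eigenspace G l \<mu> s)"
      using sum_enat_gt_1[OF A(3)] by (metis leI)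
    have nonzero: "\<exists>f\<in>eigenspace G l \<mu> q. (LINT x|\<mu>. f x * f x) \<noteq> 0"
      if pos: "0 < L2_dim \<mu> (eigenspace G l \<mu> q)" for q
    proof -
      obtain F where F: "F 0 \<in> eigenspace G l \<mu> q" "L2_independent \<mu> (Suc 0) F"
        using L2_dim_greater[OF pos[unfolded zero_enat_def]] by auto
      have "\<not> (AE x in \<mu>. F 0 x = 0)"
        using F(2)[unfolded L2_independent_def, rule_format, of "\<lambda>_. 1" 0] by auto
      then have "(LINT x|\<mu>. F 0 x * F 0 x) \<noteq> 0"
        using H1_integrable_mult[OF \<mu>] eigenspace_H1[OF F(1)]
        by (subst integral_nonneg_eq_0_iff_AE) auto
      then show ?thesis using F(1) by blast
    qed
    obtain f g where f: "f \<in> eigenspace G l \<mu> r" "(LINT x|\<mu>. f x * f x) \<noteq> 0"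
      and g: "g \<in> eigenspace G l \<mu> s" "(LINT x|\<mu>. g x * g x) \<noteq> 0"
      using nonzero rs by blast
    have orth: "(LINT x|\<mu>. f x * g x) = 0"
      using f(1) g(1) rs(3) by (rule eigenspace_orthogonal)
    have i: "integrable \<mu> (\<lambda>x. f x * f x)" "integrable \<mu> (\<lambda>x. f x * g x)"
      "integrable \<mu> (\<lambda>x. g x * g x)"
      using H1_integrable_mult[OF \<mu>] eigenspace_H1[OF f(1)] eigenspace_H1[OF g(1)] by auto
    have "\<alpha> = 0 \<and> \<beta> = 0" if ae: "AE x in \<mu>. \<alpha> * f x + \<beta> * g x = 0" for \<alpha> \<beta>
    proof -
      \<comment> \<open>The relation is multiplied by f, then by g, and integrated; orthogonality
        leaves \<alpha> and \<beta> times nonzero square integrals.\<close>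
      have "(LINT x|\<mu>. \<alpha> * (f x * f x) + \<beta> * (f x * g x)) = 0"
        by (rule integral_eq_zero_AE) (use ae in eventually_elim, algebra)
      moreover have "(LINT x|\<mu>. \<alpha> * (f x * g x) + \<beta> * (g x * g x)) = 0"
        by (rule integral_eq_zero_AE) (use ae in eventually_elim, algebra)
      ultimately show ?thesis using i f(2) g(2) orth by simp
    qed
    moreover have "r \<le> t" "s \<le> t" using rs A(2) by auto
    ultimately show ?thesis using f(1) g(1) by blast
  qed
qed

theorem corollary4p2:
  fixes G :: "('v, 'e) pre_digraph" and l :: "'e \<Rightarrow> real"
    and M :: "('v, 'e) point measure set"
  assumes "metric_graph G l"
    and "M \<subseteq> prob_measures G l"
    and "weak_star_topology G l closure_of M = prob_measures G l"
  shows "\<forall>k\<ge>1. (SUP \<mu>\<in>M. eigenvalue G l \<mu> k) = \<infinity>"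
proof (intro allI impI)
  fix k :: nat assume k: "k \<ge> 1"
  interpret metric_graph G l by fact
  obtain x0 D where x0: "x0 \<in> points G l"
    and D: "continuous_map (graph_topology G l) euclideanreal D" "D x0 = 0"
    and bound: "\<And>f w x. weak_gradient f w \<Longrightarrow> x \<in> points G l \<Longrightarrow>
      (f x - f x0)\<^sup>2 \<le> D x * gradient_energy w"
    using ex_modulus by blast
  \<comment> \<open>Taking the positive part keeps continuity, the zero at \<open>x0\<close> and the
    increment bound, and makes the integral nonnegative.\<close>
  let ?D = "\<lambda>x. max 0 (D x)"
  have cD: "continuous_map (graph_topology G l) euclideanreal ?D"
    using D(1) by (intro continuous_intros) auto
  have bound': "(f x - f x0)\<^sup>2 \<le> ?D x * gradient_energy w"
    if "weak_gradient f w" "x \<in> points G l" for f w x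
    using bound[OF that] mult_right_mono[of "D x" "?D x" "gradient_energy w"]
      gradient_energy_nonneg[of w] by fastforce
  have "\<exists>\<mu>\<in>M. ereal (real n) \<le> eigenvalue G l \<mu> k" for n
  proof -
    \<comment> \<open>The threshold makes n times the integral at most n/(n + 1) < 1.\<close>
    have "\<exists>\<mu>\<in>M. (LINT y|\<mu>. ?D y) < 1 / real (Suc n)"
      using assms x0 cD D(2) by (intro weak_star_dense_near_point) auto
    then obtain \<mu> where \<mu>: "\<mu> \<in> M" "(LINT y|\<mu>. ?D y) < 1 / real (Suc n)"
      by blast
    then have \<mu>N: "\<mu> \<in> prob_measures G l" using assms by blast
    have D0: "0 \<le> (LINT y|\<mu>. ?D y)" by simp
    \<comment> \<open>It suffices to bound every level t whose count exceeds k; if there is none,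
      the infimum defining the eigenvalue is infinite.\<close>
    have "ereal (real n) \<le> ereal t" if t: "enat k < eigenvalue_count G l \<mu> t" for t
    proof (rule ccontr)
      assume "\<not> ereal (real n) \<le> ereal t"
      then have tn: "t < real n" by simp
      have "1 < eigenvalue_count G l \<mu> t"
        using t k by (metis enat_ord_simps(1) one_enat_def order_le_less_trans)
      then obtain r s f g where rs: "r \<le> t" "s \<le> t"
        and fg: "f \<in> eigenspace G l \<mu> r" "g \<in> eigenspace G l \<mu> s"
        and indep: "\<forall>\<alpha> \<beta>. (AE x in \<mu>. \<alpha> * f x + \<beta> * g x = 0) \<longrightarrow> \<alpha> = 0 \<and> \<beta> = 0"
        using eigenvalue_count_gt_1[OF \<mu>N] by blast
      \<comment> \<open>The level n replaces t because the bound requires a nonnegative level, while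
        t is arbitrary below n.\<close>
      have "1 \<le> real n * (LINT y|\<mu>. ?D y)"
      proof (rule independent_eigenfunctions_bound[OF \<mu>N cD _ fg])
        show "(f x - f x0)\<^sup>2 \<le> ?D x * gradient_energy w"
          if "weak_gradient f w" "x \<in> points G l" for f w x
          using that by (rule bound')
        show "r \<le> real n" "s \<le> real n" "0 \<le> real n" using rs tn by auto
        show "0 \<le> (LINT y|\<mu>. ?D y)" by (rule D0)
        show "\<alpha> = 0 \<and> \<beta> = 0" if "AE x in \<mu>. \<alpha> * f x + \<beta> * g x = 0" for \<alpha> \<beta>
          using indep that by blast
      qed
      also have "\<dots> \<le> real n * (1 / real (Suc n))"
        using \<mu> by (intro mult_left_mono) auto
      also have "\<dots> < 1" by simp
      finally show False by simp
    qed
    then have "ereal (real n) \<le> eigenvalue G l \<mu> k"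
      unfolding eigenvalue_def by (intro Inf_greatest) auto
    then show ?thesis using \<mu>(1) by blast
  qed
  then show "(SUP \<mu>\<in>M. eigenvalue G l \<mu> k) = \<infinity>"
    by (intro SUP_PInfty)
qed

end
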